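(* Let $G=(V,E)$ be a finite decomposable graph. 1. Let $r>0$, $\alpha\in(0,\infty)^V$, $\beta>0$. Suppose $X\sim\operatorname{Dir}_G(\alpha,\beta)$ and, conditionally on $X$, the random vectors $N^{(1)},\ldots,N^{(k)}$ are independent with $\mathbb P_{N^{(j)}\mid X}=\operatorname{nm}_G(r,X)$ for $j=1,\ldots,k$. Then the posterior distribution is $$\mathbb P_{X\mid N^{(1)},\ldots,N^{(k)}}=\operatorname{Dir}_G(\alpha+N^{(1)}+\cdots+N^{(k)},\,\beta+kr),$$ and the (unconditional) distribution of a single observation $N$ (i.e. of each $N^{(j)}$) is $$\mathbb P(N=n)=\genfrac{[}{]}{0pt}{}{|n|+r-1}{n}_G\,\frac{K_G(\alpha,\beta)}{K_G(\alpha+n,\beta+r)},\qquad n\in\mathbb N^V.$$ 2. Let $r\in\{1,2,\ldots\}$, $\alpha\in(0,\infty)^V$, $\beta>\max_{C\in\mathcal C_G^+}|\alpha_C|$. Suppose $X\sim\operatorname{IDir}_G(\alpha,\beta)$ and, conditionally on $X$, the random vectors $N^{(1)},\ldots,N^{(k)}$ are independent with $\mathbb P_{N^{(j)}\mid X}=\operatorname{mult}_G(r,X)$ for $j=1,\ldots,k$. Then the posterior distribution is $$\mathbb P_{X\mid N^{(1)},\ldots,N^{(k)}}=\operatorname{IDir}_G(\alpha+N^{(1)}+\cdots+N^{(k)},\,\beta+kr),$$ and the (unconditional) distribution of a single observation $N$ is $$\mathbb P(N=n)=\binom{r}{n}_G\,\frac{k_G(\alpha,\beta)}{k_G(\alpha+n,\beta+r)},\qquad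 n\in\mathbb N_{G,r}.$$
   Context: $\mathbb N=\{0,1,2,\ldots\}$. $G=(V,E)$ is a finite undirected simple graph; $G^*$ its complement graph; $G_A$ the subgraph induced by $A\subset V$. A clique is a set of pairwise adjacent vertices ($\emptyset$ and singletons are cliques); $\mathcal C_G$ is the set of cliques and $\mathcal C_G^+$ the set of maximal cliques. $G$ is decomposable iff it is chordal (no induced cycle of length greater than 3); it may be disconnected. $\Delta_G(x)=\sum_{C\in\mathcal C_{G^*}}(-1)^{|C|}\prod_{i\in C}x_i$, $\delta_G(y)=\sum_{C\in\mathcal C_{G^*}}\prod_{i\in C}y_i$; for $A\subset V$, $\Delta_A(x):=\Delta_{G_A}(x_A)$, $\Delta_\emptyset=1$; $M_G=\{x\in(0,\infty)^V:\Delta_A(x)>0\ \forall A\subset V\}$. $x_A=(x_i)_{i\in A}$, $x^n=\prod_{i\in V}x_i^{n_i}$, $|n_A|=\sum_{i\in A}n_i$, $|n|=|n_V|$ (same notation for $\alpha$). For an integer $r\ge1$, $\binom{r}{n}_G$ is defined by $\delta_G(y)^r=\sum_{n\in\mathbb N^V}\binom{r}{n}_G y^n$; for real $r>0$, $\genfrac{[}{]}{0pt}{}{|n|+r-1}{n}_G$ is defined by the formal power series $\Delta_G(x)^{-r}=\sum_{n\in\mathbb N^V}\genfrac{[}{]}{0pt}{}{|n|+r-1}{n}_G x^n$. $\operatorname{nm}_G(r,x)$ ($r>0$, $x\in M_G$) is the law with $\mathbb P(N=n)=\genfrac{[}{]}{0pt}{}{|n|+r-1}{n}_G\,x^n\Delta_G(x)^r$,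 $n\in\mathbb N^V$. $\operatorname{mult}_G(r,y)$ ($r\in\{1,2,\ldots\}$, $y\in(0,\infty)^V$) is the law with $\mathbb P(N=n)=\binom{r}{n}_G\,y^n\delta_G(y)^{-r}$, $n\in\mathbb N_{G,r}:=\{n\in\mathbb N^V:\max_{C\in\mathcal C_G^+}|n_C|\le r\}$. $\operatorname{Dir}_G(\alpha,\beta)$ ($\alpha\in(0,\infty)^V$, $\beta>0$) has Lebesgue density $K_G(\alpha,\beta)\Delta_G(x)^{\beta-1}\prod_i x_i^{\alpha_i-1}\mathbf 1_{M_G}(x)$, and $\operatorname{IDir}_G(\alpha,\beta)$ ($\alpha\in(0,\infty)^V$, $\beta>\max_{C\in\mathcal C_G^+}|\alpha_C|$) has density $k_G(\alpha,\beta)\delta_G(y)^{-\beta}\prod_i y_i^{\alpha_i-1}\mathbf 1_{(0,\infty)^V}(y)$, where $K_G(\alpha,\beta)$ and $k_G(\alpha,\beta)$ are the (finite, positive) normalizing constants. Explicitly, $$K_G(\alpha,\beta)=\frac{\prod_{C\in\mathcal C_G^+}\Gamma(|\alpha_C|+\beta)}{\Gamma(\beta)^m\prod_{i\in V}\Gamma(\alpha_i)\prod_{S\in\mathcal S_G^-}\Gamma(|\alpha_S|+\beta)^{\nu_S}},\qquad k_G(\alpha,\beta)=\frac{\Gamma(\beta)^m\prod_{S\in\mathcal S_G^-}\Gamma(\beta-|\alpha_S|)^{\nu_S}}{\prod_{i\in V}\Gamma(\alpha_i)\prod_{C\in\mathcal C_G^+}\Gamma(\beta-|\alpha_C|)},$$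 where $m$ is the number of connected components of $G$ and, for any ordering $C_1,\ldots,C_K$ of the maximal cliques such that for each $k\ge2$ the set $S_k=C_k\cap(C_1\cup\cdots\cup C_{k-1})$ is contained in some $C_\ell$, $\ell<k$, $\mathcal S_G^-$ is the set of nonempty $S_k$'s and $\nu_S$ is the number of $k$ with $S_k=S$. *)

theory Defs
  imports "HOL-Probability.Probability" "HOL-Library.Poly_Mapping"
begin

section \<open>Graphs\<close>

text \<open>A graph is a pair of a vertex set and a set of two-element edges.\<close>

type_synonym 'v graph = "'v set \<times> 'v set set"

abbreviation verts :: "'v graph \<Rightarrow> 'v set" where "verts G \<equiv> fst G"
abbreviation edges :: "'v graph \<Rightarrow> 'v set set" where "edges G \<equiv> snd G"

definition all_pairs :: "'v set \<Rightarrow> 'v set set" where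
  "all_pairs V = {{u, v} | u v. u \<in> V \<and> v \<in> V \<and> u \<noteq> v}"

definition finite_simple_graph :: "'v graph \<Rightarrow> bool" where
  "finite_simple_graph G \<longleftrightarrow> finite (verts G) \<and> edges G \<subseteq> all_pairs (verts G)"

definition complement_graph :: "'v graph \<Rightarrow> 'v graph" where
  "complement_graph G = (verts G, all_pairs (verts G) - edges G)"

definition induced_subgraph :: "'v graph \<Rightarrow> 'v set \<Rightarrow> 'v graph" where
  "induced_subgraph G A = (A, {e \<in> edges G. e \<subseteq> A})"

definition cliques :: "'v graph \<Rightarrow> 'v set set" where
  "cliques G = {C. C \<subseteq> verts G \<and> (\<forall>u\<in>C. \<forall>v\<in>C. u \<noteq> v \<longrightarrow> {u, v} \<in> edges G)}"

definition max_cliques :: "'v graph \<Rightarrow> 'v set set" where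
  "max_cliques G = {C \<in> cliques G. \<forall>D\<in>cliques G. C \<subseteq> D \<longrightarrow> D = C}"

definition induced_cycle :: "'v graph \<Rightarrow> 'v list \<Rightarrow> bool" where
  "induced_cycle G c \<longleftrightarrow> distinct c \<and> length c \<ge> 3 \<and> set c \<subseteq> verts G \<and>
     (\<forall>i<length c. \<forall>j<length c. {c ! i, c ! j} \<in> edges G \<longleftrightarrow>
        j = Suc i mod length c \<or> i = Suc j mod length c)"

definition decomposable :: "'v graph \<Rightarrow> bool" where
  "decomposable G \<longleftrightarrow> \<not> (\<exists>c. induced_cycle G c \<and> length c > 3)"


section \<open>Clique polynomials and their coefficients\<close>

text \<open>Both polynomials are defined over an arbitrary commutative ring, so that they can be
  evaluated at real vectors as well as at formal indeterminates.\<close>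

definition Delta :: "'v graph \<Rightarrow> ('v \<Rightarrow> 'r::comm_ring_1) \<Rightarrow> 'r" where
  "Delta G x = (\<Sum>C\<in>cliques (complement_graph G). (-1) ^ card C * (\<Prod>i\<in>C. x i))"

definition delta :: "'v graph \<Rightarrow> ('v \<Rightarrow> 'r::comm_ring_1) \<Rightarrow> 'r" where
  "delta G y = (\<Sum>C\<in>cliques (complement_graph G). \<Prod>i\<in>C. y i)"

definition indet :: "'v \<Rightarrow> ('v \<Rightarrow>\<^sub>0 nat) \<Rightarrow>\<^sub>0 real" where
  "indet i = Poly_Mapping.single (Poly_Mapping.single i 1) 1"

definition monomial_index :: "'v set \<Rightarrow> ('v \<Rightarrow> nat) \<Rightarrow> ('v \<Rightarrow>\<^sub>0 nat)" where
  "monomial_index V n = (\<Sum>i\<in>V. Poly_Mapping.single i (n i))"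

definition mult_coeff :: "'v graph \<Rightarrow> nat \<Rightarrow> ('v \<Rightarrow> nat) \<Rightarrow> real" where
  "mult_coeff G r n = Poly_Mapping.lookup (delta G indet ^ r) (monomial_index (verts G) n)"

text \<open>The coefficient of \<open>x\<^sup>n\<close> in the formal power series \<open>\<Delta>\<^sub>G(x)\<close> to the power \<open>-r\<close>.
  With \<open>u = 1 - \<Delta>\<^sub>G\<close>, a polynomial without constant term, this series is the sum over all
  \<open>m\<close> of \<open>(m + r - 1 gchoose m) u\<^sup>m\<close>, and only the terms with \<open>m \<le> |n|\<close> contribute
  to the coefficient of \<open>x\<^sup>n\<close>.\<close>

definition nm_coeff :: "'v graph \<Rightarrow> real \<Rightarrow> ('v \<Rightarrow> nat) \<Rightarrow> real" where
  "nm_coeff G r n = (\<Sum>m\<le>(\<Sum>i\<in>verts G. n i).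
     ((real m + r - 1) gchoose m) *
       Poly_Mapping.lookup ((1 - Delta G indet) ^ m) (monomial_index (verts G) n))"


section \<open>The graph distributions\<close>

text \<open>Vectors indexed by the vertex set are extensional functions, as in \<open>PiM\<close> and \<open>PiE\<close>.\<close>

abbreviation vert_lborel :: "'v graph \<Rightarrow> ('v \<Rightarrow> real) measure" where
  "vert_lborel G \<equiv> PiM (verts G) (\<lambda>_. lborel)"

abbreviation vert_counts :: "'v graph \<Rightarrow> ('v \<Rightarrow> nat) set" where
  "vert_counts G \<equiv> verts G \<rightarrow>\<^sub>E UNIV"

definition pos_vecs :: "'v graph \<Rightarrow> ('v \<Rightarrow> real) set" where
  "pos_vecs G = verts G \<rightarrow>\<^sub>E {0<..}"

definition M_set :: "'v graph \<Rightarrow> ('v \<Rightarrow> real) set" where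
  "M_set G = {x \<in> pos_vecs G. \<forall>A\<subseteq>verts G. Delta (induced_subgraph G A) x > 0}"

definition mult_support :: "'v graph \<Rightarrow> nat \<Rightarrow> ('v \<Rightarrow> nat) set" where
  "mult_support G r =
     {n \<in> vert_counts G. Max ((\<lambda>C. \<Sum>i\<in>C. n i) ` max_cliques G) \<le> r}"

text \<open>\<open>nm_law G r x\<close> is meaningful for \<open>x \<in> M_set G\<close> and \<open>mult_law G r y\<close> for
  \<open>y \<in> pos_vecs G\<close>; other arguments give junk values.\<close>

definition nm_law :: "'v graph \<Rightarrow> real \<Rightarrow> ('v \<Rightarrow> real) \<Rightarrow> ('v \<Rightarrow> nat) measure" where
  "nm_law G r x = density (count_space (vert_counts G))
     (\<lambda>n. ennreal (nm_coeff G r n * (\<Prod>i\<in>verts G. x i ^ n i) * Delta G x powr r))"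

definition mult_law :: "'v graph \<Rightarrow> nat \<Rightarrow> ('v \<Rightarrow> real) \<Rightarrow> ('v \<Rightarrow> nat) measure" where
  "mult_law G r y = density (count_space (vert_counts G))
     (\<lambda>n. ennreal (mult_coeff G r n * (\<Prod>i\<in>verts G. y i ^ n i) / delta G y ^ r
                     * indicator (mult_support G r) n))"

definition Dir_kernel :: "'v graph \<Rightarrow> ('v \<Rightarrow> real) \<Rightarrow> real \<Rightarrow> ('v \<Rightarrow> real) \<Rightarrow> real" where
  "Dir_kernel G \<alpha> \<beta> x =
     Delta G x powr (\<beta> - 1) * (\<Prod>i\<in>verts G. x i powr (\<alpha> i - 1)) * indicator (M_set G) x"

definition IDir_kernel :: "'v graph \<Rightarrow> ('v \<Rightarrow> real) \<Rightarrow> real \<Rightarrow> ('v \<Rightarrow> real) \<Rightarrow> real" where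
  "IDir_kernel G \<alpha> \<beta> y =
     delta G y powr (- \<beta>) * (\<Prod>i\<in>verts G. y i powr (\<alpha> i - 1)) * indicator (pos_vecs G) y"

definition Dir_const :: "'v graph \<Rightarrow> ('v \<Rightarrow> real) \<Rightarrow> real \<Rightarrow> real" where
  "Dir_const G \<alpha> \<beta> = 1 / (\<integral>x. Dir_kernel G \<alpha> \<beta> x \<partial>vert_lborel G)"

definition IDir_const :: "'v graph \<Rightarrow> ('v \<Rightarrow> real) \<Rightarrow> real \<Rightarrow> real" where
  "IDir_const G \<alpha> \<beta> = 1 / (\<integral>y. IDir_kernel G \<alpha> \<beta> y \<partial>vert_lborel G)"

definition Dir_law :: "'v graph \<Rightarrow> ('v \<Rightarrow> real) \<Rightarrow> real \<Rightarrow> ('v \<Rightarrow> real) measure" where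
  "Dir_law G \<alpha> \<beta> =
     density (vert_lborel G) (\<lambda>x. ennreal (Dir_const G \<alpha> \<beta> * Dir_kernel G \<alpha> \<beta> x))"

definition IDir_law :: "'v graph \<Rightarrow> ('v \<Rightarrow> real) \<Rightarrow> real \<Rightarrow> ('v \<Rightarrow> real) measure" where
  "IDir_law G \<alpha> \<beta> =
     density (vert_lborel G) (\<lambda>y. ennreal (IDir_const G \<alpha> \<beta> * IDir_kernel G \<alpha> \<beta> y))"


section \<open>Conditional distributions and conditional independence\<close>

definition has_law :: "'w measure \<Rightarrow> 's measure \<Rightarrow> ('w \<Rightarrow> 's) \<Rightarrow> 's measure \<Rightarrow> bool" where
  "has_law M S Y \<mu> \<longleftrightarrow> Y \<in> M \<rightarrow>\<^sub>M S \<and> distr M S Y = \<mu>"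

text \<open>\<open>cond_prob_given M Z T A\<close> is (a version of) the conditional probability of the event \<open>A\<close>
  given the sigma-algebra generated by the \<open>T\<close>-valued random variable \<open>Z\<close>.\<close>

definition cond_prob_given ::
    "'w measure \<Rightarrow> ('w \<Rightarrow> 't) \<Rightarrow> 't measure \<Rightarrow> 'w set \<Rightarrow> 'w \<Rightarrow> real" where
  "cond_prob_given M Z T A = real_cond_exp M (vimage_algebra (space M) Z T) (indicator A)"

text \<open>\<open>has_cond_law M S Y T Z \<kappa>\<close> says that \<open>\<kappa> (Z)\<close> is a regular conditional distribution
  of the \<open>S\<close>-valued random variable \<open>Y\<close> given \<open>Z\<close>. The values of \<open>\<kappa>\<close> need to be probability
  measures on \<open>S\<close> only almost surely, because the parametric families above are defined only for
  admissible parameters.\<close>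

definition has_cond_law ::
    "'w measure \<Rightarrow> 's measure \<Rightarrow> ('w \<Rightarrow> 's) \<Rightarrow> 't measure \<Rightarrow> ('w \<Rightarrow> 't) \<Rightarrow>
     ('t \<Rightarrow> 's measure) \<Rightarrow> bool" where
  "has_cond_law M S Y T Z \<kappa> \<longleftrightarrow>
     Y \<in> M \<rightarrow>\<^sub>M S \<and> Z \<in> M \<rightarrow>\<^sub>M T \<and>
     (AE \<omega> in M. prob_space (\<kappa> (Z \<omega>)) \<and> sets (\<kappa> (Z \<omega>)) = sets S) \<and>
     (\<forall>B\<in>sets S. AE \<omega> in M.
        cond_prob_given M Z T {\<omega>' \<in> space M. Y \<omega>' \<in> B} \<omega> = measure (\<kappa> (Z \<omega>)) B)"

definition cond_indep_vars_given ::
    "'w measure \<Rightarrow> ('w \<Rightarrow> 't) \<Rightarrow> 't measure \<Rightarrow> ('i \<Rightarrow> 's measure) \<Rightarrow> ('i \<Rightarrow> 'w \<Rightarrow> 's) \<Rightarrow>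
     'i set \<Rightarrow> bool" where
  "cond_indep_vars_given M Z T S Y I \<longleftrightarrow>
     Z \<in> M \<rightarrow>\<^sub>M T \<and> (\<forall>i\<in>I. Y i \<in> M \<rightarrow>\<^sub>M S i) \<and>
     (\<forall>J B. J \<subseteq> I \<and> finite J \<and> (\<forall>j\<in>J. B j \<in> sets (S j)) \<longrightarrow>
        (AE \<omega> in M.
           cond_prob_given M Z T {\<omega>' \<in> space M. \<forall>j\<in>J. Y j \<omega>' \<in> B j} \<omega> =
           (\<Prod>j\<in>J. cond_prob_given M Z T {\<omega>' \<in> space M. Y j \<omega>' \<in> B j} \<omega>)))"

end

theory Submission
  imports Defs "HOL-Computational_Algebra.Formal_Power_Series"
begin

text \<open>Both parts are instances of conjugacy. On the set where it is positive, the \<open>Dir\<close> kernel is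
\<open>\<Delta>(x) powr (\<beta> - 1) * \<Prod> x\<^sub>i powr (\<alpha>\<^sub>i - 1)\<close>, and the negative multinomial probability of \<open>n\<close> is a
coefficient times \<open>\<Prod> x\<^sub>i ^ n\<^sub>i * \<Delta>(x) powr r\<close>. The product is again a kernel, with parameters
\<open>(\<alpha> + n, \<beta> + r)\<close>, and Bayes' formula turns this identity into the posterior (lemma
\<open>posterior_of_observations\<close>) and into the law of a single observation as a quotient of normalizing
constants (lemma \<open>law_of_observation\<close>). The \<open>IDir\<close> kernels and the multinomial laws behave in the
same way with \<open>\<delta>(y)\<close> in place of \<open>1 / \<Delta>(x)\<close>.

The observations are discrete. So the conditional law of \<open>X\<close> given them has to be checked only on
the events that fix their values, and only for values of positive probability. For such a value,
finiteness and positivity of the new normalizing constant follow from the joint law itself: the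
probability of the value is a positive multiple of the integral of the new kernel.

The remaining point is that the coefficients are nonnegative, for otherwise the sampling
probabilities would not be given by the formula above. For the multinomial coefficients this is
clear. For the coefficients of \<open>\<Delta> powr (-r)\<close> with real \<open>r > 0\<close> (lemma \<open>nm_coeff_nonneg\<close>), grade the
variables by \<open>t\<close> and let \<open>D\<^sub>A\<close> be the polynomial of the subgraph induced by \<open>A\<close>. Deleting a vertex
\<open>v\<close> of \<open>C\<close>, with \<open>A = C - {v}\<close> and \<open>B\<close> the set of vertices of \<open>A\<close> not adjacent to \<open>v\<close>, gives
\<open>D\<^sub>C = D\<^sub>A - t x\<^sub>v D\<^sub>B = D\<^sub>A (1 - H)\<close> with \<open>H = t x\<^sub>v D\<^sub>B / D\<^sub>A\<close>. By induction on the number of vertices,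
all ratios \<open>D\<^sub>S / D\<^sub>C\<close> with \<open>S \<subseteq> C\<close> and the logarithmic derivative \<open>- D\<^sub>C' / D\<^sub>C\<close> have nonnegative
coefficients (lemma \<open>graded_ratio_nonneg\<close>), and the differential equation \<open>F' = r F (- D' / D)\<close> of
\<open>F = D powr (-r)\<close> passes this on to \<open>F\<close>.\<close>

unbundle no vec_syntax
unbundle fps_syntax

section \<open>Power series with nonnegative polynomial coefficients\<close>

definition nonneg_poly :: "('a \<Rightarrow>\<^sub>0 real) \<Rightarrow> bool" where
  "nonneg_poly p \<longleftrightarrow> (\<forall>k. Poly_Mapping.lookup p k \<ge> 0)"

lemma nonneg_poly_0: "nonneg_poly 0"
  by (simp add: nonneg_poly_def)

lemma nonneg_poly_single: "c \<ge> 0 \<Longrightarrow> nonneg_poly (Poly_Mapping.single k c)"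
  by (simp add: nonneg_poly_def lookup_single when_def)

lemma nonneg_poly_1: "nonneg_poly (1 :: ('a::zero) \<Rightarrow>\<^sub>0 real)"
  by (simp add: nonneg_poly_single flip: single_one)

lemma nonneg_poly_add: "nonneg_poly p \<Longrightarrow> nonneg_poly q \<Longrightarrow> nonneg_poly (p + q)"
  by (simp add: nonneg_poly_def lookup_add)

lemma nonneg_poly_sum: "(\<And>i. i \<in> I \<Longrightarrow> nonneg_poly (f i)) \<Longrightarrow> nonneg_poly (sum f I)"
  by (simp add: nonneg_poly_def lookup_sum sum_nonneg)

lemma nonneg_poly_mult:
  fixes p q :: "('a::monoid_add) \<Rightarrow>\<^sub>0 real"
  assumes "nonneg_poly p" "nonneg_poly q"
  shows "nonneg_poly (p * q)"
  using assms unfolding nonneg_poly_def lookup_mult Sum_any.expand_set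
  by (auto intro!: sum_nonneg mult_nonneg_nonneg simp: when_def)

lemma nonneg_poly_prod:
  fixes f :: "'i \<Rightarrow> ('a::comm_monoid_add) \<Rightarrow>\<^sub>0 real"
  shows "(\<And>i. i \<in> I \<Longrightarrow> nonneg_poly (f i)) \<Longrightarrow> nonneg_poly (prod f I)"
  by (induction I rule: infinite_finite_induct) (auto intro: nonneg_poly_1 nonneg_poly_mult)

lemma nonneg_poly_power:
  fixes p :: "('a::comm_monoid_add) \<Rightarrow>\<^sub>0 real"
  shows "nonneg_poly p \<Longrightarrow> nonneg_poly (p ^ n)"
  by (induction n) (auto intro: nonneg_poly_1 nonneg_poly_mult)

definition nonneg_series :: "(('a::comm_monoid_add) \<Rightarrow>\<^sub>0 real) fps \<Rightarrow> bool" where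
  "nonneg_series F \<longleftrightarrow> (\<forall>n. nonneg_poly (F $ n))"

lemma nonneg_series_1: "nonneg_series 1"
  by (simp add: nonneg_series_def nonneg_poly_0 nonneg_poly_1)

lemma nonneg_series_add: "nonneg_series F \<Longrightarrow> nonneg_series H \<Longrightarrow> nonneg_series (F + H)"
  by (simp add: nonneg_series_def nonneg_poly_add)

lemma nonneg_series_mult: "nonneg_series F \<Longrightarrow> nonneg_series H \<Longrightarrow> nonneg_series (F * H)"
  by (auto simp: nonneg_series_def fps_mult_nth intro!: nonneg_poly_sum nonneg_poly_mult)

lemma nonneg_poly_of_nat: "nonneg_poly (of_nat n :: ('a::comm_monoid_add) \<Rightarrow>\<^sub>0 real)"
  by (simp add: nonneg_poly_def lookup_of_nat when_def)

lemma nonneg_series_deriv: "nonneg_series F \<Longrightarrow> nonneg_series (fps_deriv F)"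
  by (auto simp: nonneg_series_def intro!: nonneg_poly_mult nonneg_poly_of_nat simp del: of_nat_Suc of_nat_add)

lemma nonneg_poly_of_nat_multD:
  fixes p :: "('a::comm_monoid_add) \<Rightarrow>\<^sub>0 real"
  assumes "nonneg_poly (of_nat n * p)" "n > 0"
  shows "nonneg_poly p"
proof -
  have "Poly_Mapping.single 0 (1 / real n) * (of_nat n :: 'a \<Rightarrow>\<^sub>0 real) = 1"
    unfolding single_of_nat[symmetric] mult_single using assms(2) by simp
  then have "p = Poly_Mapping.single 0 (1 / real n) * (of_nat n * p)"
    by (simp flip: mult.assoc)
  moreover have "nonneg_poly (Poly_Mapping.single 0 (1 / real n) * (of_nat n * p))"
    by (intro nonneg_poly_mult nonneg_poly_single assms) simp
  ultimately show ?thesis by simp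
qed

text \<open>The inverse of \<open>1 - H\<close> satisfies \<open>J = 1 + H * J\<close>; as \<open>H\<close> has no constant term, this
computes each coefficient of \<open>J\<close> from the earlier ones by additions and multiplications only.\<close>

lemma nonneg_series_geometric:
  assumes H: "nonneg_series H" "H $ 0 = 0" and J: "(1 - H) * J = 1"
  shows "nonneg_series J"
proof -
  have JH: "J = 1 + H * J" using J by (simp add: algebra_simps)
  have "nonneg_poly (J $ n)" for n
  proof (induction n rule: less_induct)
    case (less n)
    have "J $ n = (1 + H * J) $ n" using JH by simp
    also have "\<dots> = 1 $ n + (\<Sum>i=0..n. H $ i * J $ (n - i))" by (simp add: fps_mult_nth)
    also have "nonneg_poly \<dots>"
    proof (intro nonneg_poly_add nonneg_poly_sum)
      show "nonneg_poly (1 $ n)" by (simp add: nonneg_poly_0 nonneg_poly_1)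
      fix i assume "i \<in> {0..n}"
      show "nonneg_poly (H $ i * J $ (n - i))"
      proof (cases "i = 0")
        case True then show ?thesis using H by (simp add: nonneg_poly_0)
      next
        case False
        then show ?thesis using H less[of "n - i"] \<open>i \<in> {0..n}\<close>
          by (intro nonneg_poly_mult) (auto simp: nonneg_series_def)
      qed
    qed
    finally show ?case .
  qed
  then show ?thesis by (simp add: nonneg_series_def)
qed

section \<open>Truncated negative binomial series\<close>

definition negbin_coeff :: "real \<Rightarrow> nat \<Rightarrow> real" where
  "negbin_coeff r m = (real m + r - 1) gchoose m"

lemma negbin_coeff_Suc:
  "real (Suc m) * negbin_coeff r (Suc m) = (real m + r) * negbin_coeff r m"
  unfolding negbin_coeff_def
  using gbinomial_absorption'[of "Suc m" "real m + r"] by (simp add: field_simps)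

abbreviation cst :: "real \<Rightarrow> (('a::comm_monoid_add) \<Rightarrow>\<^sub>0 real) fps" where
  "cst c \<equiv> fps_const (Poly_Mapping.single 0 c)"

text \<open>The partial sums of the series \<open>(1 - U) powr (-r)\<close>. The truncation at \<open>K\<close> is the one that
occurs in \<^const>\<open>nm_coeff\<close>; it is exact up to degree \<open>K\<close> when \<open>U\<close> has no constant term.\<close>

definition negbin_sum :: "real \<Rightarrow> nat \<Rightarrow> (('a::comm_monoid_add) \<Rightarrow>\<^sub>0 real) fps \<Rightarrow> ('a \<Rightarrow>\<^sub>0 real) fps" where
  "negbin_sum r K U = (\<Sum>m\<le>K. cst (negbin_coeff r m) * U ^ m)"

lemma cst_mult: "cst a * cst b = cst (a * b)"
  by (simp add: mult_single)

lemma cst_add: "cst a + cst b = cst (a + b)"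
  by (simp add: single_add)

text \<open>This is the differential equation \<open>F' (1 - U) = r F U'\<close> of \<open>F = (1 - U) powr (-r)\<close>, with the
error that the truncation causes. Each step of the induction shifts the error term by one power
of \<open>U\<close>.\<close>

lemma negbin_sum_deriv:
  "fps_deriv (negbin_sum r K U) * (1 - U) =
     cst r * negbin_sum r K U * fps_deriv U
     - cst ((real K + r) * negbin_coeff r K) * U ^ K * fps_deriv U"
proof (induction K)
  case 0
  then show ?case by (simp add: negbin_sum_def negbin_coeff_def mult_single)
next
  case (Suc K)
  define c where "c = negbin_coeff r (Suc K)"
  have c: "(real K + r) * negbin_coeff r K = real (Suc K) * c"
    unfolding c_def by (simp only: negbin_coeff_Suc)
  have s: "negbin_sum r (Suc K) U = negbin_sum r K U + cst c * U ^ Suc K"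
    by (simp add: negbin_sum_def c_def)
  have d: "fps_deriv (cst c * U ^ Suc K) = cst (real (Suc K) * c) * U ^ K * fps_deriv U"
    by (simp add: fps_deriv_power mult_single ac_simps flip: single_of_nat del: of_nat_Suc power_Suc)
  have e: "cst ((real (Suc K) + r) * c) = cst (real (Suc K) * c) + cst r * cst c"
    unfolding cst_mult cst_add by (simp add: algebra_simps)
  have "fps_deriv (negbin_sum r (Suc K) U) * (1 - U) =
      fps_deriv (negbin_sum r K U) * (1 - U) + fps_deriv (cst c * U ^ Suc K) * (1 - U)"
    by (simp only: s fps_deriv_add distrib_right)
  also have "\<dots> = cst r * negbin_sum r K U * fps_deriv U
      - cst (real (Suc K) * c) * U ^ K * fps_deriv U
      + cst (real (Suc K) * c) * U ^ K * fps_deriv U * (1 - U)"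
    unfolding Suc.IH d c ..
  also have "\<dots> = cst r * (negbin_sum r K U + cst c * U ^ Suc K) * fps_deriv U
     - (cst (real (Suc K) * c) + cst r * cst c) * U ^ Suc K * fps_deriv U"
    by (simp add: algebra_simps del: fps_const_mult fps_const_add)
  also have "\<dots> = cst r * negbin_sum r (Suc K) U * fps_deriv U
     - cst ((real (Suc K) + r) * c) * U ^ Suc K * fps_deriv U"
    by (simp only: s e)
  finally show ?case by (simp only: c_def)
qed

text \<open>With \<open>D = 1 - U\<close>, the series \<open>F = D powr (-r)\<close> satisfies \<open>F' = r F L\<close>, where \<open>L = - D' / D\<close>
is the derivative of \<open>- ln D\<close>. So \<open>F\<close> inherits nonnegativity from \<open>L\<close> for every
real \<open>r > 0\<close>, coefficient by coefficient, although the powers of \<open>U\<close> may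
have coefficients of both signs.\<close>

lemma negbin_sum_nonneg:
  assumes U0: "U $ 0 = 0" and inv: "(1 - U) * I = 1"
    and L: "nonneg_series (fps_deriv U * I)" and r: "r > 0" and n: "n \<le> K"
  shows "nonneg_poly (negbin_sum r K U $ n)"
  using n
proof (induction n rule: less_induct)
  case (less n)
  let ?F = "negbin_sum r K U" and ?L = "fps_deriv U * I"
  show ?case
  proof (cases n)
    case 0
    have "?F $ 0 = (\<Sum>m\<le>K. Poly_Mapping.single 0 (negbin_coeff r m) * (if m = 0 then 1 else 0))"
      unfolding negbin_sum_def fps_sum_nth
      by (intro sum.cong) (auto simp: fps_power_zeroth U0 zero_power)
    also have "\<dots> = (\<Sum>m\<le>K. if m = 0 then 1 else 0)"
      by (intro sum.cong) (auto simp: negbin_coeff_def)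
    also have "\<dots> = 1" by simp
    finally show ?thesis using 0 by (simp add: nonneg_poly_1)
  next
    case (Suc j)
    have "fps_deriv ?F = fps_deriv ?F * (1 - U) * I" using inv by (simp add: mult.assoc)
    also have "\<dots> = cst r * (?F * ?L) - cst ((real K + r) * negbin_coeff r K) * (U ^ K * ?L)"
      unfolding negbin_sum_deriv by (simp add: algebra_simps)
    finally have ode: "fps_deriv ?F = \<dots>" .
    \<comment> \<open>The truncation error starts only in degree \<open>K\<close>, and \<open>j < K\<close>.\<close>
    have "(U ^ K * ?L) $ j = 0"
      unfolding fps_mult_nth[of "U ^ K"]
      using startsby_zero_power_prefix[OF U0, of K] less.prems Suc by (intro sum.neutral) auto
    then have "fps_deriv ?F $ j = Poly_Mapping.single 0 r * (?F * ?L) $ j"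
      by (subst ode) simp
    also have "nonneg_poly \<dots>"
      unfolding fps_mult_nth[of ?F] using less Suc r L
      by (intro nonneg_poly_mult nonneg_poly_single nonneg_poly_sum)
         (auto simp: nonneg_series_def)
    finally have "nonneg_poly (of_nat (j + 1) * ?F $ (j + 1))" unfolding fps_deriv_nth .
    from nonneg_poly_of_nat_multD[OF this] show ?thesis using Suc by simp
  qed
qed

section \<open>Grading polynomials by total degree\<close>

definition monomial_degree :: "('v \<Rightarrow>\<^sub>0 nat) \<Rightarrow> nat" where
  "monomial_degree k = (\<Sum>i. Poly_Mapping.lookup k i)"

lemma monomial_degree_add: "monomial_degree (k + l) = monomial_degree k + monomial_degree l"
  by (simp add: monomial_degree_def lookup_add Sum_any.distrib)

lemma monomial_degree_0: "monomial_degree 0 = 0"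
  by (simp add: monomial_degree_def)

lemma monomial_degree_single: "monomial_degree (Poly_Mapping.single i c) = c"
  by (simp add: monomial_degree_def lookup_single)

lemma monomial_degree_monomial_index: "monomial_degree (monomial_index V n) = (\<Sum>i\<in>V. n i)"
  unfolding monomial_index_def
  by (induction V rule: infinite_finite_induct)
     (simp_all add: monomial_degree_0 monomial_degree_add monomial_degree_single)

text \<open>Substituting \<open>t x\<^sub>i\<close> for each indeterminate \<open>x\<^sub>i\<close> and expanding in powers of \<open>t\<close> gives a ring
homomorphism into power series in \<open>t\<close>. The coefficient of \<open>t ^ n\<close> is the homogeneous part of
degree \<open>n\<close>, so no information about single monomials is lost, while formal inverses and
derivatives with respect to \<open>t\<close> become available.\<close>

definition by_degree :: "(('v \<Rightarrow>\<^sub>0 nat) \<Rightarrow>\<^sub>0 real) \<Rightarrow> (('v \<Rightarrow>\<^sub>0 nat) \<Rightarrow>\<^sub>0 real) fps" where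
  "by_degree p = (\<Sum>k\<in>Poly_Mapping.keys p.
     fps_const (Poly_Mapping.single k (Poly_Mapping.lookup p k)) * fps_X ^ monomial_degree k)"

lemma lookup_by_degree:
  "Poly_Mapping.lookup (by_degree p $ n) k = (if monomial_degree k = n then Poly_Mapping.lookup p k else 0)"
proof -
  have "Poly_Mapping.lookup (by_degree p $ n) k = (\<Sum>l\<in>Poly_Mapping.keys p.
      Poly_Mapping.lookup (Poly_Mapping.single l (Poly_Mapping.lookup p l) * (if n = monomial_degree l then 1 else 0)) k)"
    by (simp add: by_degree_def fps_sum_nth lookup_sum)
  also have "\<dots> = (\<Sum>l\<in>Poly_Mapping.keys p. if l = k then
      (if monomial_degree k = n then Poly_Mapping.lookup p k else 0) else 0)"
    by (intro sum.cong) (auto simp: lookup_single when_def)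
  also have "\<dots> = (if monomial_degree k = n then Poly_Mapping.lookup p k else 0)"
    by (auto simp: in_keys_iff)
  finally show ?thesis .
qed

lemma by_degree_eqI:
  "(\<And>k n. Poly_Mapping.lookup (F $ n) k = (if monomial_degree k = n then Poly_Mapping.lookup p k else 0))
    \<Longrightarrow> by_degree p = F"
  by (intro fps_ext poly_mapping_eqI) (simp add: lookup_by_degree)

lemma by_degree_0: "by_degree 0 = 0"
  by (rule by_degree_eqI) simp

lemma by_degree_1: "by_degree 1 = 1"
  by (rule by_degree_eqI) (auto simp: lookup_one when_def monomial_degree_0)

lemma by_degree_add: "by_degree (p + q) = by_degree p + by_degree q"
  by (rule by_degree_eqI) (simp add: lookup_add lookup_by_degree)

lemma by_degree_diff: "by_degree (p - q) = by_degree p - by_degree q"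
  by (rule by_degree_eqI) (simp add: lookup_minus lookup_by_degree)

lemma by_degree_uminus: "by_degree (- p) = - by_degree p"
  using by_degree_diff[of 0 p] by (simp add: by_degree_0)

lemma by_degree_sum: "by_degree (sum f I) = (\<Sum>i\<in>I. by_degree (f i))"
  by (induction I rule: infinite_finite_induct) (simp_all add: by_degree_0 by_degree_add)

lemma by_degree_single:
  "by_degree (Poly_Mapping.single k c) = fps_const (Poly_Mapping.single k c) * fps_X ^ monomial_degree k"
  by (rule by_degree_eqI) (auto simp: lookup_single when_def)

lemma poly_mapping_sum_single: "(\<Sum>k\<in>Poly_Mapping.keys p. Poly_Mapping.single k (Poly_Mapping.lookup p k)) = p"
  by (rule poly_mapping_eqI) (auto simp: lookup_sum lookup_single when_def in_keys_iff)

lemma by_degree_mult: "by_degree (p * q) = by_degree p * by_degree q"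
proof -
  let ?s = "\<lambda>p k. Poly_Mapping.single k (Poly_Mapping.lookup p k)"
  have "by_degree (p * q) =
      by_degree ((\<Sum>k\<in>Poly_Mapping.keys p. ?s p k) * (\<Sum>l\<in>Poly_Mapping.keys q. ?s q l))"
    by (simp only: poly_mapping_sum_single)
  also have "\<dots> = (\<Sum>k\<in>Poly_Mapping.keys p. \<Sum>l\<in>Poly_Mapping.keys q. by_degree (?s p k * ?s q l))"
    by (simp only: sum_product by_degree_sum)
  also have "\<dots> = (\<Sum>k\<in>Poly_Mapping.keys p. \<Sum>l\<in>Poly_Mapping.keys q. by_degree (?s p k) * by_degree (?s q l))"
    unfolding mult_single by_degree_single monomial_degree_add power_add
    by (simp add: ac_simps flip: mult_single fps_const_mult)
  also have "\<dots> = by_degree (\<Sum>k\<in>Poly_Mapping.keys p. ?s p k) * by_degree (\<Sum>l\<in>Poly_Mapping.keys q. ?s q l)"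
    by (simp only: sum_product by_degree_sum)
  finally show ?thesis by (simp only: poly_mapping_sum_single)
qed

lemma by_degree_power: "by_degree (p ^ m) = by_degree p ^ m"
  by (induction m) (simp_all add: by_degree_1 by_degree_mult)

lemma by_degree_prod: "by_degree (prod f I) = (\<Prod>i\<in>I. by_degree (f i))"
  by (induction I rule: infinite_finite_induct) (simp_all add: by_degree_1 by_degree_mult)

lemma by_degree_Delta: "by_degree (Delta G x) = Delta G (\<lambda>i. by_degree (x i))"
  by (simp add: Delta_def by_degree_sum by_degree_mult by_degree_power by_degree_prod
      by_degree_uminus by_degree_1)


section \<open>Deletion of a vertex from the clique polynomial\<close>

definition independent_sets :: "'v graph \<Rightarrow> 'v set \<Rightarrow> 'v set set" where
  "independent_sets G A = {C. C \<subseteq> A \<and> (\<forall>u\<in>C. \<forall>v\<in>C. u \<noteq> v \<longrightarrow> {u, v} \<notin> edges G)}"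

lemma cliques_complement_induced:
  "cliques (complement_graph (induced_subgraph G A)) = independent_sets G A"
  by (fastforce simp: cliques_def complement_graph_def induced_subgraph_def
      independent_sets_def all_pairs_def)

lemma Delta_induced:
  "Delta (induced_subgraph G A) x = (\<Sum>C\<in>independent_sets G A. (-1) ^ card C * (\<Prod>i\<in>C. x i))"
  by (simp add: Delta_def cliques_complement_induced)

lemma finite_independent_sets: "finite A \<Longrightarrow> finite (independent_sets G A)"
  by (simp add: independent_sets_def)

lemma independent_sets_empty: "independent_sets G {} = {{}}"
  by (auto simp: independent_sets_def)

lemma independent_sets_insert:
  "independent_sets G (insert v A) =
     independent_sets G A \<union> insert v ` independent_sets G {u \<in> A. {u, v} \<notin> edges G}"
  (is "?L = ?R")
proof
  show "?L \<subseteq> ?R"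
  proof
    fix C assume C: "C \<in> ?L"
    show "C \<in> ?R"
    proof (cases "v \<in> C")
      case True
      then have "C - {v} \<in> independent_sets G {u \<in> A. {u, v} \<notin> edges G}" "C = insert v (C - {v})"
        using C by (auto simp: independent_sets_def)
      then show ?thesis by blast
    qed (use C in \<open>auto simp: independent_sets_def\<close>)
  qed
  show "?R \<subseteq> ?L"
    by (auto simp: independent_sets_def insert_commute)
qed

text \<open>An independent set either avoids \<open>v\<close>, or consists of \<open>v\<close> and an independent set of
vertices that are not adjacent to \<open>v\<close>.\<close>

lemma Delta_insert:
  assumes "finite A" "v \<notin> A"
  shows "Delta (induced_subgraph G (insert v A)) x =
    Delta (induced_subgraph G A) x
      - x v * Delta (induced_subgraph G {u \<in> A. {u, v} \<notin> edges G}) x"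
proof -
  let ?B = "{u \<in> A. {u, v} \<notin> edges G}" and ?f = "\<lambda>C. (-1) ^ card C * (\<Prod>i\<in>C. x i)"
  have fin: "finite (independent_sets G A)" "finite (independent_sets G ?B)"
    using assms by (simp_all add: finite_independent_sets)
  have notin: "v \<notin> C" "finite C" if "C \<in> independent_sets G ?B" for C
    using that assms by (auto simp: independent_sets_def intro: finite_subset)
  have inj: "inj_on (insert v) (independent_sets G ?B)"
    by (rule inj_onI) (use notin in \<open>metis insert_ident\<close>)
  have "independent_sets G A \<inter> insert v ` independent_sets G ?B = {}"
    using assms by (auto simp: independent_sets_def)
  then have "Delta (induced_subgraph G (insert v A)) x =
      sum ?f (independent_sets G A) + sum ?f (insert v ` independent_sets G ?B)"
    unfolding Delta_induced independent_sets_insert using fin by (subst sum.union_disjoint) auto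
  also have "sum ?f (insert v ` independent_sets G ?B) = (\<Sum>C\<in>independent_sets G ?B. - (x v * ?f C))"
    unfolding sum.reindex[OF inj] using notin by (intro sum.cong) (auto simp: ac_simps)
  finally show ?thesis by (simp add: Delta_induced sum_negf sum_distrib_left)
qed

section \<open>Nonnegativity of the coefficients\<close>

definition graded_Delta :: "'v graph \<Rightarrow> 'v set \<Rightarrow> (('v \<Rightarrow>\<^sub>0 nat) \<Rightarrow>\<^sub>0 real) fps" where
  "graded_Delta G A = Delta (induced_subgraph G A) (\<lambda>i. fps_X * fps_const (indet i))"

abbreviation graded_inverse :: "'v graph \<Rightarrow> 'v set \<Rightarrow> (('v \<Rightarrow>\<^sub>0 nat) \<Rightarrow>\<^sub>0 real) fps" where
  "graded_inverse G A \<equiv> fps_right_inverse (graded_Delta G A) 1"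

lemma graded_Delta_empty: "graded_Delta G {} = 1"
  by (simp add: graded_Delta_def Delta_induced independent_sets_empty)

lemma graded_Delta_insert:
  assumes "finite A" "v \<notin> A"
  shows "graded_Delta G (insert v A) = graded_Delta G A
    - fps_X * fps_const (indet v) * graded_Delta G {u \<in> A. {u, v} \<notin> edges G}"
  unfolding graded_Delta_def by (rule Delta_insert[OF assms])

lemma graded_Delta_nth_0: "finite A \<Longrightarrow> graded_Delta G A $ 0 = 1"
  by (induction A rule: finite_induct) (simp_all add: graded_Delta_empty graded_Delta_insert)

lemma graded_Delta_inverse: "finite A \<Longrightarrow> graded_Delta G A * graded_inverse G A = 1"
  by (rule fps_right_inverse) (simp add: graded_Delta_nth_0)

lemma nonneg_series_X_indet: "nonneg_series (fps_X * fps_const (indet v))"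
  by (auto simp: nonneg_series_def indet_def nonneg_poly_0 nonneg_poly_single fps_X_def)

text \<open>Write \<open>D\<^sub>C\<close> for the graded polynomial of \<open>C\<close>, and let \<open>C\<close> arise from \<open>A\<close> by adding a vertex
\<open>v\<close>. The deletion formula reads \<open>D\<^sub>C = D\<^sub>A (1 - H)\<close> with \<open>H = t x\<^sub>v D\<^sub>B / D\<^sub>A\<close>, where \<open>B \<subseteq> A\<close> are the
vertices not adjacent to \<open>v\<close>. By induction \<open>H\<close> is nonnegative, hence so are
\<open>D\<^sub>A / D\<^sub>C = 1 / (1 - H)\<close> and \<open>- D\<^sub>C' / D\<^sub>C = - D\<^sub>A' / D\<^sub>A + H' / (1 - H)\<close>. For a general subset \<open>S\<close> of
\<open>C\<close> the ratio \<open>D\<^sub>S / D\<^sub>C\<close> is a product of such one-vertex ratios. The ratios have to be carried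
along in the induction because they are what makes \<open>H\<close> nonnegative in the next step.\<close>

lemma graded_ratio_nonneg:
  assumes "finite C"
  shows "(\<forall>B\<subseteq>C. nonneg_series (graded_Delta G B * graded_inverse G C)) \<and>
         nonneg_series (- fps_deriv (graded_Delta G C) * graded_inverse G C)"
  using assms
proof (induction "card C" arbitrary: C rule: less_induct)
  case less
  let ?D = "graded_Delta G" and ?I = "graded_inverse G"
  note inv = graded_Delta_inverse[of _ G]
  have step: "nonneg_series (?D (C - {v}) * ?I C) \<and> nonneg_series (- fps_deriv (?D C) * ?I C)"
    if v: "v \<in> C" for v
  proof -
    define A where "A = C - {v}"
    define H where "H = fps_X * fps_const (indet v) * (?D {u \<in> A. {u, v} \<notin> edges G} * ?I A)"
    define J where "J = ?D A * ?I C"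
    have A: "finite A" "v \<notin> A" "C = insert v A" "card A < card C"
      using v less.prems card_Diff1_less[OF less.prems v] unfolding A_def by auto
    note IH = less.hyps[OF A(4) A(1)]
    have DC: "?D C = ?D A * (1 - H)"
    proof -
      have "?D A * H = fps_X * fps_const (indet v) * ?D {u \<in> A. {u, v} \<notin> edges G} * (?D A * ?I A)"
        unfolding H_def by (simp only: ac_simps)
      then show ?thesis
        unfolding A(3) graded_Delta_insert[OF A(1,2)] by (simp add: inv A algebra_simps)
    qed
    have H: "nonneg_series H" unfolding H_def using IH
      by (auto intro!: nonneg_series_mult[OF nonneg_series_X_indet])
    have H0: "H $ 0 = 0" by (simp add: H_def)
    have HJ: "(1 - H) * J = 1"
      using inv[OF less.prems] unfolding DC J_def by (simp add: ac_simps)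
    have J: "nonneg_series J" using nonneg_series_geometric[OF H H0 HJ] .
    have IC: "?I C = ?I A * J"
    proof -
      have "?I C = ?I C * (?D A * ?I A)" by (simp add: inv A)
      then show ?thesis by (simp add: J_def ac_simps)
    qed
    have "- fps_deriv (?D C) * ?I C =
        - fps_deriv (?D A) * ?I A * ((1 - H) * J) + fps_deriv H * J * (?D A * ?I A)"
    proof -
      have "fps_deriv (?D C) = fps_deriv (?D A) * (1 - H) - ?D A * fps_deriv H"
        unfolding DC by (simp add: algebra_simps)
      then show ?thesis by (simp only: IC) (simp add: algebra_simps)
    qed
    also have "\<dots> = - fps_deriv (?D A) * ?I A + fps_deriv H * J"
      using A by (simp add: HJ inv)
    finally have "nonneg_series (- fps_deriv (?D C) * ?I C)"
      using IH H J by (simp only: nonneg_series_add nonneg_series_mult nonneg_series_deriv)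
    then show ?thesis using J unfolding J_def A_def by blast
  qed
  show ?case
  proof (intro conjI allI impI)
    fix B assume B: "B \<subseteq> C"
    show "nonneg_series (?D B * ?I C)"
    proof (cases "B = C")
      case True
      then show ?thesis using less.prems by (simp add: inv nonneg_series_1)
    next
      case False
      then obtain w where w: "w \<in> C" "w \<notin> B" using B by blast
      let ?A = "C - {w}"
      have A: "finite ?A" "card ?A < card C" "B \<subseteq> ?A"
        using less.prems w B card_Diff1_less[OF less.prems w(1)] by auto
      have "?D B * ?I C = ?D B * ?I C * (?D ?A * ?I ?A)" using A by (simp add: inv)
      also have "\<dots> = ?D B * ?I ?A * (?D ?A * ?I C)" by (simp only: ac_simps)
      finally show ?thesis
        using less.hyps[OF A(2,1)] A(3) step[OF w(1)] by (auto intro: nonneg_series_mult)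
    qed
  next
    show "nonneg_series (- fps_deriv (?D C) * ?I C)"
    proof (cases "C = {}")
      case True then show ?thesis by (simp add: graded_Delta_empty nonneg_series_def nonneg_poly_0)
    next
      case False then show ?thesis using step by blast
    qed
  qed
qed

lemma induced_subgraph_verts: "finite_simple_graph G \<Longrightarrow> induced_subgraph G (verts G) = G"
  by (auto simp: finite_simple_graph_def induced_subgraph_def all_pairs_def intro!: prod_eqI)

text \<open>The density of \<^const>\<open>nm_law\<close> is cut off at zero by \<^const>\<open>ennreal\<close>, so the formula for
its point probabilities rests on this sign. The monomial in question has degree \<open>K = |n|\<close>, so its
coefficient can be read off from the coefficient of \<open>t ^ K\<close> of the graded series.\<close>

lemma nm_coeff_nonneg:
  assumes G: "finite_simple_graph G" and r: "r > 0"
  shows "nm_coeff G r n \<ge> 0"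
proof -
  define K where "K = (\<Sum>i\<in>verts G. n i)"
  define k where "k = monomial_index (verts G) n"
  define D where "D = graded_Delta G (verts G)"
  have fin: "finite (verts G)" using G by (simp add: finite_simple_graph_def)
  have k: "monomial_degree k = K" by (simp add: k_def K_def monomial_degree_monomial_index)
  have D: "by_degree (Delta G indet) = D"
    by (simp add: by_degree_Delta D_def graded_Delta_def induced_subgraph_verts[OF G])
       (simp add: indet_def by_degree_single monomial_degree_single mult.commute)
  have "Poly_Mapping.lookup ((1 - Delta G indet) ^ m) k = Poly_Mapping.lookup ((1 - D) ^ m $ K) k" for m
    using lookup_by_degree[of "(1 - Delta G indet) ^ m" K k]
    by (simp add: k by_degree_power by_degree_diff by_degree_1 D)
  then have "nm_coeff G r n = Poly_Mapping.lookup (negbin_sum r K (1 - D) $ K) k"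
    by (simp add: nm_coeff_def negbin_sum_def negbin_coeff_def fps_sum_nth lookup_sum lookup_mult
        lookup_single when_mult flip: K_def k_def)
  moreover have "nonneg_poly (negbin_sum r K (1 - D) $ K)"
    using graded_Delta_nth_0[OF fin, of G] graded_Delta_inverse[OF fin, of G]
      graded_ratio_nonneg[OF fin, of G] r
    by (intro negbin_sum_nonneg[where I = "graded_inverse G (verts G)"]) (auto simp: D_def)
  ultimately show ?thesis by (simp add: nonneg_poly_def)
qed

lemma mult_coeff_nonneg: "mult_coeff G r n \<ge> 0"
proof -
  have "nonneg_poly (delta G indet ^ r)"
    unfolding delta_def indet_def
    by (intro nonneg_poly_power nonneg_poly_sum nonneg_poly_prod nonneg_poly_single) simp
  then show ?thesis by (simp add: mult_coeff_def nonneg_poly_def)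
qed

section \<open>Bayes' formula for discrete observations\<close>

lemma subalgebra_vimage_algebra:
  assumes "X \<in> M \<rightarrow>\<^sub>M S"
  shows "subalgebra M (vimage_algebra (space M) X S)"
  using measurable_sets[OF assms] measurable_space[OF assms]
  by (auto simp: subalgebra_def sets_vimage_algebra2)

text \<open>A version \<open>h(X)\<close> of the conditional probability of \<open>E\<close> given \<open>X\<close> determines the joint
probabilities of \<open>E\<close> and the events of \<open>X\<close>: these events are exactly those over which the
defining property of the conditional expectation may be integrated.\<close>

lemma (in prob_space) cond_prob_given_integral:
  assumes X: "X \<in> M \<rightarrow>\<^sub>M S" and E: "E \<in> sets M" and B: "B \<in> sets S"
    and cp: "AE \<omega> in M. cond_prob_given M X S E \<omega> = h (X \<omega>)"
    and h: "h \<in> borel_measurable S" "\<And>x. h x \<ge> 0"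
  shows "emeasure M {\<omega> \<in> E. X \<omega> \<in> B} = (\<integral>\<^sup>+x. ennreal (h x) * indicator B x \<partial>distr M S X)"
proof -
  let ?F = "vimage_algebra (space M) X S" and ?A = "X -` B \<inter> space M"
  interpret finite_measure_subalgebra M ?F
    by unfold_locales (rule subalgebra_vimage_algebra[OF X])
  have A: "?A \<in> sets ?F" using B by (rule in_vimage_algebra)
  have [measurable]: "?A \<in> sets M" "X \<in> M \<rightarrow>\<^sub>M S" "h \<in> borel_measurable S" "E \<in> sets M" "B \<in> sets S"
    using X B h E by auto
  have intE: "integrable M (indicator E :: _ \<Rightarrow> real)"
    by (intro integrable_real_indicator E) (simp add: less_top[symmetric])
  have eq: "AE \<omega> in M. indicator ?A \<omega> *\<^sub>R real_cond_exp M ?F (indicator E) \<omega> = indicator ?A \<omega> *\<^sub>R h (X \<omega>)"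
    using cp by eventually_elim (simp add: cond_prob_given_def)
  have "integrable M (\<lambda>\<omega>. indicator ?A \<omega> *\<^sub>R real_cond_exp M ?F (indicator E) \<omega>)"
    by (intro integrable_mult_indicator real_cond_exp_int(1) intE) simp
  then have int: "integrable M (\<lambda>\<omega>. indicator ?A \<omega> *\<^sub>R h (X \<omega>))"
    by (rule integrable_cong_AE_imp) (use eq in auto)
  have "measure M {\<omega> \<in> E. X \<omega> \<in> B} = (\<integral>\<omega>. indicator {\<omega> \<in> E. X \<omega> \<in> B} \<omega> \<partial>M)"
    using sets.sets_into_space[OF E] by (simp add: Int_absorb2 subset_iff)
  also have "\<dots> = (\<integral>\<omega>\<in>?A. indicator E \<omega> \<partial>M)"
    unfolding set_lebesgue_integral_def
    by (intro Bochner_Integration.integral_cong) (use sets.sets_into_space[OF E] in \<open>auto simp: indicator_def\<close>)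
  also have "\<dots> = (\<integral>\<omega>\<in>?A. real_cond_exp M ?F (indicator E) \<omega> \<partial>M)"
    by (rule real_cond_exp_intA[OF intE A])
  also have "\<dots> = (\<integral>\<omega>. indicator ?A \<omega> *\<^sub>R h (X \<omega>) \<partial>M)"
    unfolding set_lebesgue_integral_def by (rule integral_cong_AE) (use eq in auto)
  finally have "emeasure M {\<omega> \<in> E. X \<omega> \<in> B} = ennreal \<dots>"
    by (simp add: emeasure_eq_measure)
  also have "\<dots> = (\<integral>\<^sup>+\<omega>. ennreal (indicator ?A \<omega> *\<^sub>R h (X \<omega>)) \<partial>M)"
    using h int by (intro nn_integral_eq_integral[symmetric]) auto
  also have "\<dots> = (\<integral>\<^sup>+\<omega>. ennreal (h (X \<omega>)) * indicator B (X \<omega>) \<partial>M)"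
    by (intro nn_integral_cong) (auto simp: indicator_def)
  also have "\<dots> = (\<integral>\<^sup>+x. ennreal (h x) * indicator B x \<partial>distr M S X)"
    by (subst nn_integral_distr) auto
  finally show ?thesis .
qed

text \<open>Given a variable with countably many values, conditional laws are elementary: only the values
of positive probability matter, and for these the quotient of probabilities has to be right.
On the other values \<open>\<kappa>\<close> may be junk.\<close>

lemma (in prob_space) has_cond_law_countableI:
  assumes X: "X \<in> M \<rightarrow>\<^sub>M S" and Z: "Z \<in> M \<rightarrow>\<^sub>M count_space A" and A: "countable A"
    and \<kappa>: "\<And>z. z \<in> A \<Longrightarrow> emeasure M {\<omega> \<in> space M. Z \<omega> = z} \<noteq> 0 \<Longrightarrow>
        prob_space (\<kappa> z) \<and> sets (\<kappa> z) = sets S \<and>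
        (\<forall>B\<in>sets S. emeasure M {\<omega> \<in> space M. Z \<omega> = z \<and> X \<omega> \<in> B} =
           emeasure M {\<omega> \<in> space M. Z \<omega> = z} * emeasure (\<kappa> z) B)"
  shows "has_cond_law M S X (count_space A) Z \<kappa>"
proof -
  let ?F = "vimage_algebra (space M) Z (count_space A)"
  let ?good = "\<lambda>z. emeasure M {\<omega> \<in> space M. Z \<omega> = z} \<noteq> 0"
  interpret finite_measure_subalgebra M ?F
    by unfold_locales (rule subalgebra_vimage_algebra[OF Z])
  note [measurable] = X Z
  have ZA: "Z \<omega> \<in> A" if "\<omega> \<in> space M" for \<omega> using measurable_space[OF Z that] by simp
  have lvl [measurable]: "{\<omega> \<in> space M. Z \<omega> = z} \<in> sets M" if "z \<in> A" for z
  proof -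
    have "Z -` {z} \<inter> space M \<in> sets M" using that by (intro measurable_sets[OF Z]) simp
    then show ?thesis by (simp add: vimage_def Int_def conj_commute)
  qed
  have "AE \<omega> in M. \<forall>z\<in>A. \<not> ?good z \<longrightarrow> Z \<omega> \<noteq> z"
    unfolding AE_ball_countable[OF A]
  proof (intro ballI)
    fix z assume z: "z \<in> A"
    show "AE \<omega> in M. \<not> ?good z \<longrightarrow> Z \<omega> \<noteq> z"
    proof (cases "?good z")
      case False
      then show ?thesis using lvl[OF z] by (intro AE_I[of _ _ "{\<omega> \<in> space M. Z \<omega> = z}"]) auto
    qed simp
  qed
  then have good: "AE \<omega> in M. ?good (Z \<omega>)"
    by (rule AE_mp) (intro AE_I2, use ZA in blast)
  have "AE \<omega> in M. cond_prob_given M Z (count_space A) {\<omega>' \<in> space M. X \<omega>' \<in> B} \<omega> = measure (\<kappa> (Z \<omega>)) B"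
    if B: "B \<in> sets S" for B
  proof -
    let ?E = "{\<omega>' \<in> space M. X \<omega>' \<in> B}"
    define g where "g z = (if z \<in> A \<and> ?good z then measure (\<kappa> z) B else 0)" for z
    have [measurable]: "B \<in> sets S" by fact
    have E [measurable]: "?E \<in> sets M" by measurable
    have g01: "0 \<le> g z" "g z \<le> 1" for z
      using \<kappa>[of z] by (auto simp: g_def prob_space.prob_le_1)
    \<comment> \<open>The integrals to be compared are the values of two measures on the countable set \<open>A\<close>,
      so it suffices to compare these measures on singletons.\<close>
    let ?n1 = "distr (density M (indicator ?E)) (count_space A) Z"
    let ?n2 = "density (distr M (count_space A) Z) (\<lambda>z. ennreal (g z))"
    have n12: "?n1 = ?n2"
    proof (rule measure_eqI_countable[OF _ _ A])
      fix z assume z: "z \<in> A"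
      have "emeasure ?n1 {z} = emeasure (density M (indicator ?E)) {\<omega> \<in> space M. Z \<omega> = z}"
        using z by (subst emeasure_distr) (auto intro!: arg_cong2[where f=emeasure])
      also have "\<dots> = emeasure M {\<omega> \<in> space M. Z \<omega> = z \<and> X \<omega> \<in> B}"
        using lvl[OF z] by (subst emeasure_density)
          (auto simp flip: nn_integral_indicator indicator_inter_arith intro!: nn_integral_cong
            split: split_indicator)
      also have "\<dots> = ennreal (g z) * emeasure M {\<omega> \<in> space M. Z \<omega> = z}"
      proof (cases "?good z")
        case True
        then interpret k: prob_space "\<kappa> z" using \<kappa>[OF z] by blast
        show ?thesis using \<kappa>[OF z True] B z True
          by (simp add: g_def k.emeasure_eq_measure mult.commute)
      next
        case False
        then have "emeasure M {\<omega> \<in> space M. Z \<omega> = z \<and> X \<omega> \<in> B} \<le> 0"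
          using emeasure_mono[of "{\<omega> \<in> space M. Z \<omega> = z \<and> X \<omega> \<in> B}" "{\<omega> \<in> space M. Z \<omega> = z}" M]
            lvl[OF z] by auto
        then show ?thesis using False by simp
      qed
      also have "\<dots> = ennreal (g z) * emeasure (distr M (count_space A) Z) {z}"
        using z by (subst emeasure_distr) (auto intro!: arg_cong2[where f=emeasure] arg_cong2[where f="(*)"])
      also have "\<dots> = emeasure ?n2 {z}"
        using z by (subst emeasure_density)
          (auto intro!: trans[OF _ nn_integral_cong[where u = "\<lambda>y. ennreal (g z) * indicator {z} y"]] simp: nn_integral_cmult_indicator split: split_indicator)
      finally show "emeasure ?n1 {z} = emeasure ?n2 {z}" .
    qed simp_all
    have gZ: "(\<lambda>\<omega>. g (Z \<omega>)) \<in> borel_measurable ?F"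
    proof (rule measurable_compose[where g = g])
      show "Z \<in> ?F \<rightarrow>\<^sub>M count_space A"
        using ZA by (intro measurable_vimage_algebra1) auto
    qed simp
    have gZM [measurable]: "(\<lambda>\<omega>. g (Z \<omega>)) \<in> borel_measurable M"
      by (rule measurable_from_subalg[OF subalg gZ])
    have "AE \<omega> in M. real_cond_exp M ?F (indicator ?E) \<omega> = g (Z \<omega>)"
    proof (rule real_cond_exp_charact[OF _ _ _ gZ])
      show "integrable M (indicator ?E :: _ \<Rightarrow> real)"
        by (intro integrable_real_indicator E) (simp add: less_top[symmetric])
      show "integrable M (\<lambda>\<omega>. g (Z \<omega>))"
        using g01 by (intro integrable_const_bound[of _ 1]) auto
      fix D assume "D \<in> sets ?F"
      then obtain D0 where D0: "D0 \<subseteq> A" "D = Z -` D0 \<inter> space M"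
        using ZA by (auto simp: sets_vimage_algebra2)
      have [measurable]: "D0 \<in> sets (count_space A)" "D \<in> sets M"
        using D0 measurable_sets[OF Z, of D0] by auto
      have "(\<integral>\<omega>\<in>D. indicator ?E \<omega> \<partial>M) = enn2real (emeasure ?n1 D0)"
      proof -
        have "emeasure ?n1 D0 = (\<integral>\<^sup>+\<omega>. ennreal (indicator D \<omega> *\<^sub>R indicator ?E \<omega>) \<partial>M)"
          using D0 by (simp add: emeasure_distr emeasure_density)
            (auto intro!: nn_integral_cong split: split_indicator)
        then show ?thesis unfolding set_lebesgue_integral_def
          by (subst integral_eq_nn_integral) auto
      qed
      also have "\<dots> = enn2real (emeasure ?n2 D0)" by (simp only: n12)
      also have "\<dots> = (\<integral>\<omega>\<in>D. g (Z \<omega>) \<partial>M)"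
      proof -
        have "emeasure ?n2 D0 = (\<integral>\<^sup>+z. ennreal (g z) * indicator D0 z \<partial>distr M (count_space A) Z)"
          by (rule emeasure_density) (use D0 in simp_all)
        also have "\<dots> = (\<integral>\<^sup>+\<omega>. ennreal (g (Z \<omega>)) * indicator D0 (Z \<omega>) \<partial>M)"
          by (rule nn_integral_distr[OF Z]) simp
        also have "\<dots> = (\<integral>\<^sup>+\<omega>. ennreal (indicator D \<omega> *\<^sub>R g (Z \<omega>)) \<partial>M)"
          using D0 by (auto intro!: nn_integral_cong split: split_indicator)
        finally show ?thesis unfolding set_lebesgue_integral_def
          using g01 by (subst integral_eq_nn_integral) auto
      qed
      finally show "(\<integral>\<omega>\<in>D. indicator ?E \<omega> \<partial>M) = (\<integral>\<omega>\<in>D. g (Z \<omega>) \<partial>M)" .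
    qed
    then show ?thesis using good AE_space
      by eventually_elim (simp add: cond_prob_given_def g_def ZA)
  qed
  moreover have "AE \<omega> in M. prob_space (\<kappa> (Z \<omega>)) \<and> sets (\<kappa> (Z \<omega>)) = sets S"
    using good AE_space by eventually_elim (use \<kappa> ZA in blast)
  ultimately show ?thesis unfolding has_cond_law_def using X Z by blast
qed

text \<open>Bayes' formula: the posterior density is proportional to prior times likelihood. The constants
of proportionality cancel, so the posterior does not see \<open>c\<close>, and the probability of \<open>z\<close> is \<open>c z\<close>
times a quotient of normalizing constants. Integrability of \<open>post z\<close> comes for free when \<open>c z > 0\<close>,
because the probability of \<open>z\<close> is a positive multiple of its integral. When \<open>c z = 0\<close>, the value
\<open>z\<close> has probability zero, and both sides of the marginal formula vanish whatever the integral is.\<close>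

lemma (in prob_space) conjugate_update:
  fixes \<mu> :: "'s measure" and Z :: "'a \<Rightarrow> 't" and c :: "'t \<Rightarrow> real" and post :: "'t \<Rightarrow> 's \<Rightarrow> real"
  assumes law: "has_law M \<mu> X (density \<mu> (\<lambda>x. ennreal (1 / (\<integral>x. prior x \<partial>\<mu>) * prior x)))"
    and prior: "prior \<in> borel_measurable \<mu>" "\<And>x. prior x \<ge> 0"
    and Z: "Z \<in> M \<rightarrow>\<^sub>M count_space A" and A: "countable A"
    and c: "\<And>z. z \<in> A \<Longrightarrow> c z \<ge> 0"
    and l: "\<And>z. z \<in> A \<Longrightarrow> l z \<in> borel_measurable \<mu>" "\<And>z x. z \<in> A \<Longrightarrow> l z x \<ge> 0"
    and post: "\<And>z x. z \<in> A \<Longrightarrow> post z x = prior x * l z x"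
    and cp: "\<And>z. z \<in> A \<Longrightarrow>
      AE \<omega> in M. cond_prob_given M X \<mu> {\<omega>' \<in> space M. Z \<omega>' = z} \<omega> = c z * l z (X \<omega>)"
  shows conjugate_posterior: "has_cond_law M \<mu> X (count_space A) Z
      (\<lambda>z. density \<mu> (\<lambda>x. ennreal (1 / (\<integral>x. post z x \<partial>\<mu>) * post z x)))"
    and conjugate_marginal: "z \<in> A \<Longrightarrow> measure M {\<omega> \<in> space M. Z \<omega> = z} =
      c z * (1 / (\<integral>x. prior x \<partial>\<mu>) / (1 / (\<integral>x. post z x \<partial>\<mu>)))"
proof -
  define K where "K = 1 / (\<integral>x. prior x \<partial>\<mu>)"
  have K: "K \<ge> 0" unfolding K_def using prior by (simp add: integral_nonneg_AE)
  have X: "X \<in> M \<rightarrow>\<^sub>M \<mu>" and dX: "distr M \<mu> X = density \<mu> (\<lambda>x. ennreal (K * prior x))"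
    using law by (auto simp: has_law_def K_def)
  note [measurable] = prior(1) X Z
  have qm [measurable]: "post z \<in> borel_measurable \<mu>" if "z \<in> A" for z
  proof -
    note [measurable] = l(1)[OF that]
    have "post z = (\<lambda>x. prior x * l z x)" using post[OF that] by blast
    then show ?thesis by simp
  qed
  have qn: "post z x \<ge> 0" if "z \<in> A" for z x using post prior l that by simp
  have lvl: "{\<omega> \<in> space M. Z \<omega> = z} \<in> sets M" if "z \<in> A" for z
  proof -
    have "Z -` {z} \<inter> space M \<in> sets M" using that by (intro measurable_sets[OF Z]) simp
    then show ?thesis by (simp add: vimage_def Int_def conj_commute)
  qed
  have joint: "emeasure M {\<omega> \<in> space M. Z \<omega> = z \<and> X \<omega> \<in> B} =
      ennreal (c z * K) * (\<integral>\<^sup>+x. ennreal (post z x) * indicator B x \<partial>\<mu>)"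
    if z: "z \<in> A" and B: "B \<in> sets \<mu>" for z B
  proof -
    note [measurable] = B l(1)[OF z] qm[OF z]
    have "{\<omega> \<in> space M. Z \<omega> = z \<and> X \<omega> \<in> B} = {\<omega> \<in> {\<omega> \<in> space M. Z \<omega> = z}. X \<omega> \<in> B}" by auto
    then have "emeasure M {\<omega> \<in> space M. Z \<omega> = z \<and> X \<omega> \<in> B} =
        (\<integral>\<^sup>+x. ennreal (c z * l z x) * indicator B x \<partial>distr M \<mu> X)"
      using cond_prob_given_integral[OF X lvl[OF z] B cp[OF z]] c[OF z] l[OF z] by simp
    also have "\<dots> = (\<integral>\<^sup>+x. ennreal (K * prior x) * (ennreal (c z * l z x) * indicator B x) \<partial>\<mu>)"
      unfolding dX by (subst nn_integral_density) auto
    also have "\<dots> = (\<integral>\<^sup>+x. ennreal (c z * K) * (ennreal (post z x) * indicator B x) \<partial>\<mu>)"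
      using c[OF z] K prior l[OF z] post[OF z]
      by (intro nn_integral_cong) (simp add: ennreal_mult ac_simps)
    also have "\<dots> = ennreal (c z * K) * (\<integral>\<^sup>+x. ennreal (post z x) * indicator B x \<partial>\<mu>)"
      by (subst nn_integral_cmult) auto
    finally show ?thesis .
  qed
  have total: "emeasure M {\<omega> \<in> space M. Z \<omega> = z} = ennreal (c z * K) * (\<integral>\<^sup>+x. ennreal (post z x) \<partial>\<mu>)"
    if z: "z \<in> A" for z
  proof -
    have "{\<omega> \<in> space M. Z \<omega> = z} = {\<omega> \<in> space M. Z \<omega> = z \<and> X \<omega> \<in> space \<mu>}"
      using measurable_space[OF X] by auto
    then have "emeasure M {\<omega> \<in> space M. Z \<omega> = z} =
        ennreal (c z * K) * (\<integral>\<^sup>+x. ennreal (post z x) * indicator (space \<mu>) x \<partial>\<mu>)"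
      using joint[OF z sets.top] by simp
    also have "(\<integral>\<^sup>+x. ennreal (post z x) * indicator (space \<mu>) x \<partial>\<mu>) = (\<integral>\<^sup>+x. ennreal (post z x) \<partial>\<mu>)"
      by (intro nn_integral_cong) simp
    finally show ?thesis .
  qed
  have finite_post: "(\<integral>\<^sup>+x. ennreal (post z x) \<partial>\<mu>) = ennreal (\<integral>x. post z x \<partial>\<mu>)"
    if z: "z \<in> A" and cK: "c z * K \<noteq> 0" for z
  proof -
    have "ennreal (c z * K) \<noteq> 0" using cK c[OF z] K by (simp add: less_le)
    moreover have "ennreal (c z * K) * (\<integral>\<^sup>+x. ennreal (post z x) \<partial>\<mu>) \<noteq> \<infinity>"
      unfolding total[OF z, symmetric] by simp
    ultimately have "(\<integral>\<^sup>+x. ennreal (post z x) \<partial>\<mu>) < \<infinity>"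
      by (metis ennreal_mult_eq_top_iff infinity_ennreal_def top.not_eq_extremum)
    then have "integrable \<mu> (post z)" using qm[OF z] qn[OF z] by (intro integrableI_nonneg) auto
    then show ?thesis using qn[OF z] by (intro nn_integral_eq_integral) auto
  qed
  show "measure M {\<omega> \<in> space M. Z \<omega> = z} = c z * (1 / (\<integral>x. prior x \<partial>\<mu>) / (1 / (\<integral>x. post z x \<partial>\<mu>)))"
    if z: "z \<in> A"
  proof (cases "c z * K = 0")
    case True
    then have "measure M {\<omega> \<in> space M. Z \<omega> = z} = 0"
      unfolding measure_def total[OF z] True by simp
    then show ?thesis using True by (auto simp: K_def)
  next
    case False
    have "measure M {\<omega> \<in> space M. Z \<omega> = z} = c z * K * (\<integral>x. post z x \<partial>\<mu>)"
      unfolding measure_def total[OF z] finite_post[OF z False]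
      using c[OF z] K qn[OF z] by (simp add: integral_nonneg_AE flip: ennreal_mult)
    then show ?thesis by (simp add: K_def)
  qed
  show "has_cond_law M \<mu> X (count_space A) Z
      (\<lambda>z. density \<mu> (\<lambda>x. ennreal (1 / (\<integral>x. post z x \<partial>\<mu>) * post z x)))"
  proof (rule has_cond_law_countableI[OF X Z A])
    fix z assume z: "z \<in> A" and pos: "emeasure M {\<omega> \<in> space M. Z \<omega> = z} \<noteq> 0"
    define I where "I = (\<integral>x. post z x \<partial>\<mu>)"
    have cK: "c z * K \<noteq> 0" using pos total[OF z] by auto
    have Iq: "(\<integral>\<^sup>+x. ennreal (post z x) \<partial>\<mu>) = ennreal I" using finite_post[OF z cK] by (simp add: I_def)
    have I: "I > 0" using pos total[OF z] Iq by (metis ennreal_neg mult_zero_right not_less)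
    note [measurable] = qm[OF z]
    have \<kappa>: "emeasure (density \<mu> (\<lambda>x. ennreal (1 / I * post z x))) B =
        ennreal (1 / I) * (\<integral>\<^sup>+x. ennreal (post z x) * indicator B x \<partial>\<mu>)" if [measurable]: "B \<in> sets \<mu>" for B
    proof -
      have "emeasure (density \<mu> (\<lambda>x. ennreal (1 / I * post z x))) B =
          (\<integral>\<^sup>+x. ennreal (1 / I) * (ennreal (post z x) * indicator B x) \<partial>\<mu>)"
        using I qn[OF z]
        by (subst emeasure_density) (auto intro!: nn_integral_cong simp: ennreal_mult' ac_simps simp del: times_divide_eq_left)
      then show ?thesis by (simp add: nn_integral_cmult)
    qed
    have "emeasure (density \<mu> (\<lambda>x. ennreal (1 / I * post z x))) (space \<mu>) =
        ennreal (1 / I) * (\<integral>\<^sup>+x. ennreal (post z x) \<partial>\<mu>)"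
      unfolding \<kappa>[OF sets.top] by (intro arg_cong2[where f = "(*)"] nn_integral_cong) auto
    also have "\<dots> = 1" using I by (simp add: Iq flip: ennreal_mult)
    finally have "prob_space (density \<mu> (\<lambda>x. ennreal (1 / I * post z x)))"
      by (intro prob_spaceI) simp
    moreover have "emeasure M {\<omega> \<in> space M. Z \<omega> = z \<and> X \<omega> \<in> B} =
        emeasure M {\<omega> \<in> space M. Z \<omega> = z} * emeasure (density \<mu> (\<lambda>x. ennreal (1 / I * post z x))) B"
      if B: "B \<in> sets \<mu>" for B
    proof -
      have "ennreal I * ennreal (1 / I) = 1" using I by (simp flip: ennreal_mult)
      then have "a = ennreal I * ennreal (1 / I) * a" for a by simp
      from this[of "\<integral>\<^sup>+x. ennreal (post z x) * indicator B x \<partial>\<mu>"] show ?thesis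
        unfolding joint[OF z B] total[OF z] \<kappa>[OF B] Iq by (simp only: mult.assoc)
    qed
    ultimately show "prob_space (density \<mu> (\<lambda>x. ennreal (1 / (\<integral>x. post z x \<partial>\<mu>) * post z x))) \<and>
        sets (density \<mu> (\<lambda>x. ennreal (1 / (\<integral>x. post z x \<partial>\<mu>) * post z x))) = sets \<mu> \<and>
        (\<forall>B\<in>sets \<mu>. emeasure M {\<omega> \<in> space M. Z \<omega> = z \<and> X \<omega> \<in> B} =
           emeasure M {\<omega> \<in> space M. Z \<omega> = z} *
           emeasure (density \<mu> (\<lambda>x. ennreal (1 / (\<integral>x. post z x \<partial>\<mu>) * post z x))) B)"
      unfolding I_def by simp
  qed
qed

section \<open>Conjugate families under repeated observation\<close>

lemma (in prob_space) AE_density_law_nonzero: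
  assumes law: "has_law M \<mu> X (density \<mu> (\<lambda>x. ennreal (c * q x)))"
    and q: "q \<in> borel_measurable \<mu>"
  shows "AE \<omega> in M. q (X \<omega>) \<noteq> (0::real)"
proof -
  have dX: "distr M \<mu> X = density \<mu> (\<lambda>x. ennreal (c * q x))"
    using law by (simp add: has_law_def)
  have "AE x in distr M \<mu> X. q x \<noteq> 0"
    unfolding dX using q by (subst AE_density) auto
  moreover have "X \<in> M \<rightarrow>\<^sub>M \<mu>" using law by (simp add: has_law_def)
  ultimately show ?thesis by (rule AE_distrD[rotated])
qed

text \<open>Conjugacy of the family \<open>ker\<close> is the one-step identity \<open>step\<close>: multiplying by the likelihood of
an observation \<open>n\<close> moves the parameters from \<open>(\<alpha>, \<beta>)\<close> to \<open>(\<alpha> + n, \<beta> + r)\<close>. By conditional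
independence the likelihood of \<open>k\<close> observations is a product, so \<open>k\<close> such steps give the
posterior. The tuple of observations takes countably many values, since \<open>k\<close> is finite.
The likelihood is prescribed only at parameters of positive prior density, which are the only
ones that \<open>X\<close> attains.\<close>

lemma (in prob_space) conjugate_observations:
  fixes \<mu> :: "'s measure" and N :: "nat \<Rightarrow> 'a \<Rightarrow> 'v \<Rightarrow> nat" and \<alpha> :: "'v \<Rightarrow> real"
    and ker :: "('v \<Rightarrow> real) \<Rightarrow> real \<Rightarrow> 's \<Rightarrow> real"
  assumes law: "has_law M \<mu> X (density \<mu> (\<lambda>x. ennreal (1 / (\<integral>x. ker \<alpha> \<beta> x \<partial>\<mu>) * ker \<alpha> \<beta> x)))"
    and ker: "ker \<alpha> \<beta> \<in> borel_measurable \<mu>" "\<And>x. ker \<alpha> \<beta> x \<ge> 0"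
    and A: "countable A"
    and step: "\<And>n \<alpha> \<beta> x. n \<in> A \<Longrightarrow> ker (\<lambda>i. \<alpha> i + real (n i)) (\<beta> + r) x = ker \<alpha> \<beta> x * L n x"
    and L: "\<And>n. n \<in> A \<Longrightarrow> L n \<in> borel_measurable \<mu>" "\<And>n x. n \<in> A \<Longrightarrow> L n x \<ge> 0"
    and C: "\<And>n. n \<in> A \<Longrightarrow> C n \<ge> 0"
    and obs: "\<And>x n. n \<in> A \<Longrightarrow> ker \<alpha> \<beta> x \<noteq> 0 \<Longrightarrow> measure (\<kappa> x) {n} = C n * L n x"
    and indep: "cond_indep_vars_given M X \<mu> (\<lambda>_. count_space A) N {1..k}"
    and N: "\<And>j. j \<in> {1..k} \<Longrightarrow> has_cond_law M (count_space A) (N j) \<mu> X \<kappa>"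
  shows posterior_of_observations: "has_cond_law M \<mu> X (PiM {1..k} (\<lambda>_. count_space A)) (\<lambda>\<omega>. \<lambda>j\<in>{1..k}. N j \<omega>)
      (\<lambda>n. density \<mu> (\<lambda>x. ennreal
         (1 / (\<integral>x. ker (\<lambda>i. \<alpha> i + (\<Sum>j=1..k. real (n j i))) (\<beta> + real k * r) x \<partial>\<mu>) *
          ker (\<lambda>i. \<alpha> i + (\<Sum>j=1..k. real (n j i))) (\<beta> + real k * r) x)))"
    and law_of_observation: "j \<in> {1..k} \<Longrightarrow> n \<in> A \<Longrightarrow> measure M {\<omega> \<in> space M. N j \<omega> = n} =
      C n * (1 / (\<integral>x. ker \<alpha> \<beta> x \<partial>\<mu>) / (1 / (\<integral>x. ker (\<lambda>i. \<alpha> i + real (n i)) (\<beta> + r) x \<partial>\<mu>)))"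
proof -
  have Nm: "N j \<in> M \<rightarrow>\<^sub>M count_space A" if "j \<in> {1..k}" for j
    using N[OF that] by (simp add: has_cond_law_def)
  have cp: "AE \<omega> in M. cond_prob_given M X \<mu> {\<omega>' \<in> space M. N j \<omega>' \<in> {n}} \<omega> = C n * L n (X \<omega>)"
    if j: "j \<in> {1..k}" and n: "n \<in> A" for j n
  proof -
    have "{n} \<in> sets (count_space A)" using n by simp
    then have "AE \<omega> in M. cond_prob_given M X \<mu> {\<omega>' \<in> space M. N j \<omega>' \<in> {n}} \<omega> = measure (\<kappa> (X \<omega>)) {n}"
      using N[OF j] unfolding has_cond_law_def by blast
    with AE_density_law_nonzero[OF law ker(1)] show ?thesis
      by eventually_elim (simp add: obs[OF n])
  qed
  show "measure M {\<omega> \<in> space M. N j \<omega> = n} =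
      C n * (1 / (\<integral>x. ker \<alpha> \<beta> x \<partial>\<mu>) / (1 / (\<integral>x. ker (\<lambda>i. \<alpha> i + real (n i)) (\<beta> + r) x \<partial>\<mu>)))"
    if j: "j \<in> {1..k}" and n: "n \<in> A"
  proof (rule conjugate_marginal[where c = C and l = L and X = X and Z = "N j" and \<mu> = \<mu> and A = A
        and z = n and post = "\<lambda>n. ker (\<lambda>i. \<alpha> i + real (n i)) (\<beta> + r)", OF law ker Nm[OF j] A])
    show "AE \<omega> in M. cond_prob_given M X \<mu> {\<omega>' \<in> space M. N j \<omega>' = m} \<omega> = C m * L m (X \<omega>)"
      if "m \<in> A" for m
      using cp[OF j that] by simp
  qed (rule n | rule C L step, assumption)+
  let ?A = "PiE {1..k} (\<lambda>_. A)" and ?Z = "\<lambda>\<omega>. \<lambda>j\<in>{1..k}. N j \<omega>"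
  have P: "PiM {1..k} (\<lambda>_. count_space A) = count_space ?A"
    by (rule count_space_PiM_finite) (use A in auto)
  have Z: "?Z \<in> M \<rightarrow>\<^sub>M count_space ?A"
    unfolding P[symmetric] using Nm by (intro measurable_restrict) auto
  have iter: "ker (\<lambda>i. \<alpha> i + (\<Sum>j\<in>J. real (z j i))) (\<beta> + real (card J) * r) x =
      ker \<alpha> \<beta> x * (\<Prod>j\<in>J. L (z j) x)"
    if "finite J" "\<And>j. j \<in> J \<Longrightarrow> z j \<in> A" for J z x
    using that
  proof (induction J rule: finite_induct)
    case (insert j J)
    have "ker (\<lambda>i. (\<alpha> i + (\<Sum>j\<in>J. real (z j i))) + real (z j i)) ((\<beta> + real (card J) * r) + r) x =
        ker (\<lambda>i. \<alpha> i + (\<Sum>j\<in>J. real (z j i))) (\<beta> + real (card J) * r) x * L (z j) x"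
      using insert.prems by (intro step) auto
    with insert show ?case by (simp add: algebra_simps)
  qed simp
  show "has_cond_law M \<mu> X (PiM {1..k} (\<lambda>_. count_space A)) ?Z
      (\<lambda>n. density \<mu> (\<lambda>x. ennreal
         (1 / (\<integral>x. ker (\<lambda>i. \<alpha> i + (\<Sum>j=1..k. real (n j i))) (\<beta> + real k * r) x \<partial>\<mu>) *
          ker (\<lambda>i. \<alpha> i + (\<Sum>j=1..k. real (n j i))) (\<beta> + real k * r) x)))"
    unfolding P
  proof (rule conjugate_posterior[where X = X and Z = ?Z and \<mu> = \<mu> and A = ?A
        and post = "\<lambda>z. ker (\<lambda>i. \<alpha> i + (\<Sum>j=1..k. real (z j i))) (\<beta> + real k * r)"
        and c = "\<lambda>z. \<Prod>j=1..k. C (z j)" and l = "\<lambda>z x. \<Prod>j=1..k. L (z j) x", OF law ker Z])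
    show "countable ?A" using A by (intro countable_PiE) auto
    fix z assume z: "z \<in> ?A"
    then have zA: "z j \<in> A" if "j \<in> {1..k}" for j using that by (rule PiE_mem)
    show "0 \<le> (\<Prod>j=1..k. C (z j))" using zA C by (intro prod_nonneg) auto
    show "(\<lambda>x. \<Prod>j=1..k. L (z j) x) \<in> borel_measurable \<mu>"
      using zA L by (intro borel_measurable_prod) auto
    show "0 \<le> (\<Prod>j=1..k. L (z j) x)" for x using zA L by (intro prod_nonneg) auto
    show "ker (\<lambda>i. \<alpha> i + (\<Sum>j=1..k. real (z j i))) (\<beta> + real k * r) x = ker \<alpha> \<beta> x * (\<Prod>j=1..k. L (z j) x)" for x
      using iter[of "{1..k}" z x] zA by simp
    have "(?Z \<omega> = z) \<longleftrightarrow> (\<forall>j\<in>{1..k}. N j \<omega> \<in> {z j})" for \<omega>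
      using z by (auto simp: fun_eq_iff restrict_def PiE_def extensional_def)
    then have event: "{\<omega>' \<in> space M. ?Z \<omega>' = z} = {\<omega>' \<in> space M. \<forall>j\<in>{1..k}. N j \<omega>' \<in> {z j}}" by simp
    have "AE \<omega> in M. cond_prob_given M X \<mu> {\<omega>' \<in> space M. \<forall>j\<in>{1..k}. N j \<omega>' \<in> {z j}} \<omega> =
        (\<Prod>j\<in>{1..k}. cond_prob_given M X \<mu> {\<omega>' \<in> space M. N j \<omega>' \<in> {z j}} \<omega>)"
    proof -
      have "{1..k} \<subseteq> {1..k} \<and> finite {1..k} \<and> (\<forall>j\<in>{1..k}. {z j} \<in> sets (count_space A))"
        using zA by simp
      with indep[unfolded cond_indep_vars_given_def, THEN conjunct2, THEN conjunct2,
          THEN spec[of _ "{1..k}"], THEN spec[of _ "\<lambda>j. {z j}"]]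
      show ?thesis by (rule mp)
    qed
    moreover have "AE \<omega> in M. \<forall>j\<in>{1..k}.
        cond_prob_given M X \<mu> {\<omega>' \<in> space M. N j \<omega>' \<in> {z j}} \<omega> = C (z j) * L (z j) (X \<omega>)"
      using cp zA by (intro AE_ball_countable') auto
    ultimately show "AE \<omega> in M. cond_prob_given M X \<mu> {\<omega>' \<in> space M. ?Z \<omega>' = z} \<omega> =
        (\<Prod>j=1..k. C (z j)) * (\<Prod>j=1..k. L (z j) (X \<omega>))"
      unfolding event by eventually_elim (simp add: prod.distrib)
  qed
qed

section \<open>The two graph families\<close>

lemma clique_complement_subset: "C \<in> cliques (complement_graph H) \<Longrightarrow> C \<subseteq> verts H"
  by (simp add: cliques_def complement_graph_def)

lemma finite_cliques_complement: "finite (verts H) \<Longrightarrow> finite (cliques (complement_graph H))"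
  by (rule finite_subset[of _ "Pow (verts H)"]) (auto dest: clique_complement_subset)

lemma measurable_vert_component [measurable]:
  "i \<in> V \<Longrightarrow> (\<lambda>x. x i) \<in> borel_measurable (PiM V (\<lambda>_. lborel :: real measure))"
  using measurable_component_singleton[of i V "\<lambda>_. lborel :: real measure"] by simp

lemma measurable_Delta:
  "verts H \<subseteq> V \<Longrightarrow> (Delta H :: _ \<Rightarrow> real) \<in> borel_measurable (PiM V (\<lambda>_. lborel))"
  unfolding Delta_def
  by (intro borel_measurable_sum borel_measurable_times borel_measurable_prod
      borel_measurable_const measurable_vert_component) (auto dest: clique_complement_subset)

lemma measurable_delta:
  "verts H \<subseteq> V \<Longrightarrow> (delta H :: _ \<Rightarrow> real) \<in> borel_measurable (PiM V (\<lambda>_. lborel))"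
  unfolding delta_def
  by (intro borel_measurable_sum borel_measurable_times borel_measurable_prod
      borel_measurable_const measurable_vert_component) (auto dest: clique_complement_subset)

lemma sets_pos_vecs:
  assumes "finite (verts G)"
  shows "pos_vecs G \<in> sets (vert_lborel G)"
  unfolding pos_vecs_def using assms by (intro sets_PiM_I_finite) auto

lemma sets_M_set:
  assumes "finite (verts G)"
  shows "M_set G \<in> sets (vert_lborel G)"
proof -
  have "{x \<in> space (vert_lborel G). \<forall>A\<in>Pow (verts G). Delta (induced_subgraph G A) x > 0} \<in> sets (vert_lborel G)"
    using assms by (intro sets.sets_Collect_finite_All borel_measurable_less borel_measurable_const measurable_Delta)
      (auto simp: induced_subgraph_def)
  moreover have "M_set G = pos_vecs G \<inter> {x \<in> space (vert_lborel G). \<forall>A\<in>Pow (verts G). Delta (induced_subgraph G A) x > 0}"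
    by (auto simp: M_set_def pos_vecs_def space_PiM PiE_def extensional_def)
  ultimately show ?thesis using sets_pos_vecs[OF assms] by simp
qed

lemma pos_vecsD: "x \<in> pos_vecs G \<Longrightarrow> i \<in> verts G \<Longrightarrow> x i > 0"
  by (auto simp: pos_vecs_def)

lemma M_setD:
  assumes "finite_simple_graph G" "x \<in> M_set G"
  shows "x \<in> pos_vecs G" "Delta G x > 0"
  using assms induced_subgraph_verts[OF assms(1)] by (auto simp: M_set_def)

lemma delta_pos:
  assumes "finite (verts G)" "x \<in> pos_vecs G"
  shows "delta G x > 0"
proof -
  have "0 < (\<Prod>i\<in>{}. x i)" by simp
  also have "\<dots> \<le> delta G x" unfolding delta_def
  proof (rule member_le_sum[where f = "\<lambda>C. \<Prod>i\<in>C. x i"])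
    show "{} \<in> cliques (complement_graph G)" by (simp add: cliques_def)
    show "finite (cliques (complement_graph G))" using assms(1) by (rule finite_cliques_complement)
    show "0 \<le> (\<Prod>i\<in>C. x i)" if "C \<in> cliques (complement_graph G) - {{}}" for C
      using that assms(2) by (intro prod_nonneg) (force dest: clique_complement_subset pos_vecsD)
  qed
  finally show ?thesis .
qed

text \<open>The part of the point probability at \<open>n\<close> that depends on the parameter. The indicator
keeps it nonnegative where the parameter is not admissible.\<close>

definition nm_likelihood :: "'v graph \<Rightarrow> real \<Rightarrow> ('v \<Rightarrow> nat) \<Rightarrow> ('v \<Rightarrow> real) \<Rightarrow> real" where
  "nm_likelihood G r n x = (\<Prod>i\<in>verts G. x i ^ n i) * Delta G x powr r * indicator (M_set G) x"

definition mult_likelihood :: "'v graph \<Rightarrow> nat \<Rightarrow> ('v \<Rightarrow> nat) \<Rightarrow> ('v \<Rightarrow> real) \<Rightarrow> real" where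
  "mult_likelihood G r n y = (\<Prod>i\<in>verts G. y i ^ n i) / delta G y ^ r * indicator (pos_vecs G) y"

lemma prod_powr_add_nat:
  assumes "x \<in> pos_vecs G"
  shows "(\<Prod>i\<in>verts G. x i powr (a i + real (n i) - 1)) =
    (\<Prod>i\<in>verts G. x i powr (a i - 1)) * (\<Prod>i\<in>verts G. x i ^ n i)"
  unfolding prod.distrib[symmetric]
proof (rule prod.cong[OF refl])
  fix i assume "i \<in> verts G"
  then have "x i > 0" by (rule pos_vecsD[OF assms])
  then have "x i powr (a i - 1) * x i ^ n i = x i powr ((a i - 1) + real (n i))"
    by (simp add: powr_add powr_realpow)
  then show "x i powr (a i + real (n i) - 1) = x i powr (a i - 1) * x i ^ n i"
    by (simp add: algebra_simps)
qed

lemma Dir_kernel_update: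
  assumes "finite_simple_graph G"
  shows "Dir_kernel G (\<lambda>i. \<alpha> i + real (n i)) (\<beta> + r) x = Dir_kernel G \<alpha> \<beta> x * nm_likelihood G r n x"
proof (cases "x \<in> M_set G")
  case True
  have "Delta G x powr (\<beta> + r - 1) = Delta G x powr (\<beta> - 1) * Delta G x powr r"
    by (simp add: algebra_simps flip: powr_add)
  then show ?thesis
    using True prod_powr_add_nat[OF M_setD(1)[OF assms True]]
    by (simp add: Dir_kernel_def nm_likelihood_def)
qed (simp add: Dir_kernel_def nm_likelihood_def)

lemma IDir_kernel_update:
  assumes "finite_simple_graph G"
  shows "IDir_kernel G (\<lambda>i. \<alpha> i + real (n i)) (\<beta> + real r) x = IDir_kernel G \<alpha> \<beta> x * mult_likelihood G r n x"
proof (cases "x \<in> pos_vecs G")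
  case True
  have d: "delta G x > 0" using assms True by (auto simp: finite_simple_graph_def intro: delta_pos)
  have "delta G x powr (- (\<beta> + real r)) = delta G x powr (- \<beta>) * inverse (delta G x powr real r)"
    unfolding powr_minus[symmetric] powr_add[symmetric] by simp
  then have "delta G x powr (- (\<beta> + real r)) = delta G x powr (- \<beta>) / delta G x ^ r"
    using d by (simp add: powr_realpow divide_inverse)
  then show ?thesis
    using True prod_powr_add_nat[OF True]
    by (simp add: IDir_kernel_def mult_likelihood_def)
qed (simp add: IDir_kernel_def mult_likelihood_def)

lemma Dir_kernel_nonneg: "Dir_kernel G \<alpha> \<beta> x \<ge> 0"
  by (auto simp: Dir_kernel_def intro!: mult_nonneg_nonneg prod_nonneg)

lemma IDir_kernel_nonneg: "IDir_kernel G \<alpha> \<beta> x \<ge> 0"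
  by (auto simp: IDir_kernel_def intro!: mult_nonneg_nonneg prod_nonneg)

lemma measurable_Dir_kernel:
  assumes "finite (verts G)"
  shows "Dir_kernel G \<alpha> \<beta> \<in> borel_measurable (vert_lborel G)"
  unfolding Dir_kernel_def
  by (intro borel_measurable_times borel_measurable_prod powr_real_measurable borel_measurable_const
      measurable_vert_component measurable_Delta borel_measurable_indicator sets_M_set assms order_refl)

lemma measurable_IDir_kernel:
  assumes "finite (verts G)"
  shows "IDir_kernel G \<alpha> \<beta> \<in> borel_measurable (vert_lborel G)"
  unfolding IDir_kernel_def
  by (intro borel_measurable_times borel_measurable_prod powr_real_measurable borel_measurable_const
      measurable_vert_component measurable_delta borel_measurable_indicator sets_pos_vecs assms order_refl)

lemma monomial_nonneg: "x \<in> pos_vecs G \<Longrightarrow> (\<Prod>i\<in>verts G. x i ^ n i) \<ge> 0"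
  by (intro prod_nonneg zero_le_power less_imp_le) (rule pos_vecsD)

lemma nm_likelihood_nonneg: "nm_likelihood G r n x \<ge> 0"
proof (cases "x \<in> M_set G")
  case True
  then have "x \<in> pos_vecs G" by (simp add: M_set_def)
  from monomial_nonneg[OF this] show ?thesis by (simp add: nm_likelihood_def)
qed (simp add: nm_likelihood_def)

lemma mult_likelihood_nonneg:
  assumes "finite (verts G)"
  shows "mult_likelihood G r n x \<ge> 0"
proof (cases "x \<in> pos_vecs G")
  case True
  from monomial_nonneg[OF True] delta_pos[OF assms True] show ?thesis
    by (simp add: mult_likelihood_def)
qed (simp add: mult_likelihood_def)

lemma measurable_nm_likelihood:
  assumes "finite (verts G)"
  shows "nm_likelihood G r n \<in> borel_measurable (vert_lborel G)"
  unfolding nm_likelihood_def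
  by (intro borel_measurable_times borel_measurable_prod powr_real_measurable borel_measurable_const borel_measurable_power
      measurable_vert_component measurable_Delta borel_measurable_indicator sets_M_set assms order_refl)

lemma measurable_mult_likelihood:
  assumes "finite (verts G)"
  shows "mult_likelihood G r n \<in> borel_measurable (vert_lborel G)"
  unfolding mult_likelihood_def
  by (intro borel_measurable_times borel_measurable_divide borel_measurable_prod borel_measurable_const borel_measurable_power
      measurable_vert_component measurable_delta borel_measurable_indicator sets_pos_vecs assms order_refl)

lemma measure_density_count_space_singleton:
  assumes "n \<in> A" "f n \<ge> 0"
  shows "measure (density (count_space A) (\<lambda>n. ennreal (f n))) {n} = f n"
  using assms by (simp add: measure_def emeasure_density)

lemma measure_nm_law:
  assumes "finite_simple_graph G" "r > 0" "n \<in> vert_counts G" "x \<in> M_set G"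
  shows "measure (nm_law G r x) {n} = nm_coeff G r n * nm_likelihood G r n x"
proof -
  have eq: "nm_coeff G r n * (\<Prod>i\<in>verts G. x i ^ n i) * Delta G x powr r =
      nm_coeff G r n * nm_likelihood G r n x"
    using assms(4) by (simp add: nm_likelihood_def)
  have "0 \<le> nm_coeff G r n * nm_likelihood G r n x"
    by (intro mult_nonneg_nonneg nm_coeff_nonneg nm_likelihood_nonneg assms)
  then show ?thesis unfolding nm_law_def
    by (subst measure_density_count_space_singleton[OF assms(3)]) (simp_all only: eq)
qed

text \<open>The indicator of the support is put into the coefficient, not into the likelihood; so the
conjugacy identity holds for all count vectors, and those outside the support get
coefficient zero.\<close>

lemma measure_mult_law:
  assumes "finite (verts G)" "n \<in> vert_counts G" "y \<in> pos_vecs G"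
  shows "measure (mult_law G r y) {n} =
    mult_coeff G r n * indicator (mult_support G r) n * mult_likelihood G r n y"
proof -
  have eq: "mult_coeff G r n * (\<Prod>i\<in>verts G. y i ^ n i) / delta G y ^ r * indicator (mult_support G r) n =
      mult_coeff G r n * indicator (mult_support G r) n * mult_likelihood G r n y"
    using assms(3) by (simp add: mult_likelihood_def)
  have "0 \<le> mult_coeff G r n * indicator (mult_support G r) n * mult_likelihood G r n y"
    by (intro mult_nonneg_nonneg mult_coeff_nonneg mult_likelihood_nonneg indicator_pos_le assms)
  then show ?thesis unfolding mult_law_def
    by (subst measure_density_count_space_singleton[OF assms(2)]) (simp_all only: eq)
qed

section \<open>Posterior laws and laws of the observations\<close>

theorem proposition6p1:
  fixes G :: "'v graph" and M :: "'w measure"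
    and X :: "'w \<Rightarrow> 'v \<Rightarrow> real" and N :: "nat \<Rightarrow> 'w \<Rightarrow> 'v \<Rightarrow> nat"
    and \<alpha> :: "'v \<Rightarrow> real" and \<beta> :: real and k :: nat
  assumes "finite_simple_graph G" and "decomposable G"
    and "prob_space M" and "k \<ge> 1" and "\<forall>i\<in>verts G. \<alpha> i > 0"
  shows
    "(\<forall>r::real. r > 0 \<longrightarrow> \<beta> > 0 \<longrightarrow>
        has_law M (vert_lborel G) X (Dir_law G \<alpha> \<beta>) \<longrightarrow>
        cond_indep_vars_given M X (vert_lborel G) (\<lambda>_. count_space (vert_counts G)) N {1..k} \<longrightarrow>
        (\<forall>j\<in>{1..k}. has_cond_law M (count_space (vert_counts G)) (N j) (vert_lborel G) X
                      (nm_law G r)) \<longrightarrow>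
        has_cond_law M (vert_lborel G) X
          (PiM {1..k} (\<lambda>_. count_space (vert_counts G))) (\<lambda>\<omega>. \<lambda>j\<in>{1..k}. N j \<omega>)
          (\<lambda>n. Dir_law G (\<lambda>i. \<alpha> i + (\<Sum>j=1..k. real (n j i))) (\<beta> + real k * r)) \<and>
        (\<forall>j\<in>{1..k}. \<forall>n\<in>vert_counts G.
           measure M {\<omega> \<in> space M. N j \<omega> = n} =
             nm_coeff G r n * (Dir_const G \<alpha> \<beta> / Dir_const G (\<lambda>i. \<alpha> i + real (n i)) (\<beta> + r))))
     \<and>
     (\<forall>r::nat. r \<ge> 1 \<longrightarrow> \<beta> > Max ((\<lambda>C. \<Sum>i\<in>C. \<alpha> i) ` max_cliques G) \<longrightarrow>
        has_law M (vert_lborel G) X (IDir_law G \<alpha> \<beta>) \<longrightarrow>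
        cond_indep_vars_given M X (vert_lborel G) (\<lambda>_. count_space (vert_counts G)) N {1..k} \<longrightarrow>
        (\<forall>j\<in>{1..k}. has_cond_law M (count_space (vert_counts G)) (N j) (vert_lborel G) X
                      (mult_law G r)) \<longrightarrow>
        has_cond_law M (vert_lborel G) X
          (PiM {1..k} (\<lambda>_. count_space (vert_counts G))) (\<lambda>\<omega>. \<lambda>j\<in>{1..k}. N j \<omega>)
          (\<lambda>n. IDir_law G (\<lambda>i. \<alpha> i + (\<Sum>j=1..k. real (n j i))) (\<beta> + real (k * r))) \<and>
        (\<forall>j\<in>{1..k}. \<forall>n\<in>mult_support G r.
           measure M {\<omega> \<in> space M. N j \<omega> = n} =
             mult_coeff G r n *
               (IDir_const G \<alpha> \<beta> / IDir_const G (\<lambda>i. \<alpha> i + real (n i)) (\<beta> + real r))))"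
proof -
  interpret prob_space M by fact
  note G = assms(1)
  have fin: "finite (verts G)" using G by (simp add: finite_simple_graph_def)
  have count: "countable (vert_counts G)" using fin by (intro countable_PiE) auto
  show ?thesis
  proof (intro conjI[where P = "\<forall>r. _ r"] allI impI)
    fix r :: real
    assume r: "r > 0" and law: "has_law M (vert_lborel G) X (Dir_law G \<alpha> \<beta>)"
      and indep: "cond_indep_vars_given M X (vert_lborel G) (\<lambda>_. count_space (vert_counts G)) N {1..k}"
      and N: "\<forall>j\<in>{1..k}. has_cond_law M (count_space (vert_counts G)) (N j) (vert_lborel G) X (nm_law G r)"
    have obs: "measure (nm_law G r x) {n} = nm_coeff G r n * nm_likelihood G r n x"
      if "n \<in> vert_counts G" "Dir_kernel G \<alpha> \<beta> x \<noteq> 0" for n x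
      using that by (intro measure_nm_law G r) (auto simp: Dir_kernel_def indicator_def split: if_splits)
    note conj = law[unfolded Dir_law_def Dir_const_def] measurable_Dir_kernel[OF fin] Dir_kernel_nonneg count
      Dir_kernel_update[OF G] measurable_nm_likelihood[OF fin] nm_likelihood_nonneg
      nm_coeff_nonneg[OF G r] obs indep N[rule_format]
    note posterior = posterior_of_observations[where ker = "Dir_kernel G" and \<alpha> = \<alpha> and \<beta> = \<beta> and r = r
        and L = "nm_likelihood G r" and C = "nm_coeff G r" and \<kappa> = "nm_law G r"]
    note marginal = law_of_observation[where ker = "Dir_kernel G" and \<alpha> = \<alpha> and \<beta> = \<beta> and r = r
        and L = "nm_likelihood G r" and C = "nm_coeff G r" and \<kappa> = "nm_law G r"]
    show "has_cond_law M (vert_lborel G) X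
          (PiM {1..k} (\<lambda>_. count_space (vert_counts G))) (\<lambda>\<omega>. \<lambda>j\<in>{1..k}. N j \<omega>)
          (\<lambda>n. Dir_law G (\<lambda>i. \<alpha> i + (\<Sum>j=1..k. real (n j i))) (\<beta> + real k * r)) \<and>
        (\<forall>j\<in>{1..k}. \<forall>n\<in>vert_counts G.
           measure M {\<omega> \<in> space M. N j \<omega> = n} =
             nm_coeff G r n * (Dir_const G \<alpha> \<beta> / Dir_const G (\<lambda>i. \<alpha> i + real (n i)) (\<beta> + r)))"
      unfolding Dir_law_def Dir_const_def
      by (intro conjI ballI; rule posterior marginal; (rule conj; assumption)?)
  next
    fix r :: nat
    assume law: "has_law M (vert_lborel G) X (IDir_law G \<alpha> \<beta>)"
      and indep: "cond_indep_vars_given M X (vert_lborel G) (\<lambda>_. count_space (vert_counts G)) N {1..k}"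
      and N: "\<forall>j\<in>{1..k}. has_cond_law M (count_space (vert_counts G)) (N j) (vert_lborel G) X (mult_law G r)"
    have obs: "measure (mult_law G r y) {n} =
        mult_coeff G r n * indicator (mult_support G r) n * mult_likelihood G r n y"
      if "n \<in> vert_counts G" "IDir_kernel G \<alpha> \<beta> y \<noteq> 0" for n y
      using that by (intro measure_mult_law fin) (auto simp: IDir_kernel_def indicator_def split: if_splits)
    have coeff: "0 \<le> mult_coeff G r n * indicator (mult_support G r) n" for n
      using mult_coeff_nonneg[of G r n] by simp
    note conj = law[unfolded IDir_law_def IDir_const_def] measurable_IDir_kernel[OF fin] IDir_kernel_nonneg count
      IDir_kernel_update[OF G] measurable_mult_likelihood[OF fin] mult_likelihood_nonneg[OF fin]
      coeff obs indep N[rule_format]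
    note posterior = posterior_of_observations[where ker = "IDir_kernel G" and \<alpha> = \<alpha> and \<beta> = \<beta>
        and r = "real r" and L = "mult_likelihood G r"
        and C = "\<lambda>n. mult_coeff G r n * indicator (mult_support G r) n" and \<kappa> = "mult_law G r"]
    note marginal = law_of_observation[where ker = "IDir_kernel G" and \<alpha> = \<alpha> and \<beta> = \<beta>
        and r = "real r" and L = "mult_likelihood G r"
        and C = "\<lambda>n. mult_coeff G r n * indicator (mult_support G r) n" and \<kappa> = "mult_law G r"]
    have post: "has_cond_law M (vert_lborel G) X
        (PiM {1..k} (\<lambda>_. count_space (vert_counts G))) (\<lambda>\<omega>. \<lambda>j\<in>{1..k}. N j \<omega>)
        (\<lambda>n. IDir_law G (\<lambda>i. \<alpha> i + (\<Sum>j=1..k. real (n j i))) (\<beta> + real (k * r)))"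
      unfolding IDir_law_def IDir_const_def of_nat_mult
      by (rule posterior; (rule conj; assumption)?)
    have "measure M {\<omega> \<in> space M. N j \<omega> = n} = mult_coeff G r n *
        (IDir_const G \<alpha> \<beta> / IDir_const G (\<lambda>i. \<alpha> i + real (n i)) (\<beta> + real r))"
      if j: "j \<in> {1..k}" and n: "n \<in> mult_support G r" for j n
    proof -
      have nV: "n \<in> vert_counts G" using n by (simp add: mult_support_def)
      have "measure M {\<omega> \<in> space M. N j \<omega> = n} = mult_coeff G r n * indicator (mult_support G r) n *
          (IDir_const G \<alpha> \<beta> / IDir_const G (\<lambda>i. \<alpha> i + real (n i)) (\<beta> + real r))"
        unfolding IDir_const_def by (rule marginal; (rule conj j nV; assumption)?)
      then show ?thesis using n by simp
    qed
    with post show "has_cond_law M (vert_lborel G) X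
          (PiM {1..k} (\<lambda>_. count_space (vert_counts G))) (\<lambda>\<omega>. \<lambda>j\<in>{1..k}. N j \<omega>)
          (\<lambda>n. IDir_law G (\<lambda>i. \<alpha> i + (\<Sum>j=1..k. real (n j i))) (\<beta> + real (k * r))) \<and>
        (\<forall>j\<in>{1..k}. \<forall>n\<in>mult_support G r.
           measure M {\<omega> \<in> space M. N j \<omega> = n} =
             mult_coeff G r n *
               (IDir_const G \<alpha> \<beta> / IDir_const G (\<lambda>i. \<alpha> i + real (n i)) (\<beta> + real r)))"
      by blast
  qed
qed

end
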